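(* Consider the distributed model predictive control (DMPC) scheme described in the context, with penalty parameter $\rho>0$, horizon $T>0$ and sampling time $\Delta t>0$, in which the ADMM algorithm is run in every MPC step with a fixed number of iterations, without evaluating a stopping criterion. Let $d>0$ (entering only through $\hat\alpha=\hat\alpha(d,\Delta t)$). Suppose that the following hold. (1) There exist a feedback law $u=\kappa_V(x)\in U$ and a non-empty compact set $\Omega_\beta=\{x\in\mathbb{R}^n: V(x)\le\beta\}$ such that $\dot V(x,\kappa_V(x))+l(x,\kappa_V(x))\le 0$ for all $x\in\Omega_\beta$, where $\dot V:=(\partial V/\partial x)F$. (2) The optimal cost $J^*$ is twice continuously differentiable, and the feedback laws $\kappa^*$ and $\kappa$ are locally Lipschitz in their arguments. (3) There exist unique bounded multipliers $\mu^*(\tau;\underline{x}_k)$, $\tau\in[0,T]$, satisfying the saddle point condition $J_\rho(w^*,z^*,\mu;\underline{x}_k)\le J_\rho(w^*,z^*,\mu^*;\underline{x}_k)\le J_\rho(w,z,\mu^*;\underline{x}_k)$, and $\mu^*(\cdot;\underline{x}_k)$ and $z^*(\cdot;\underline{x}_k)$ are locally Lipschitz (in $\underline{x}_k$) for all $\underline{x}_k\in\Gamma_\alpha$. (4) There exist $\sigma_\mu,\sigma_z>0$ such that $\mu^q(\cdot;\underline{x}_k)\in\mathcal{M}_\alpha^{\sigma_\mu}$ and $z^q(\cdot;\underline{x}_k)\in\mathcal{Z}_\alpha^{\sigma_z}$ for the given initialization ($q=0$) and all subsequent ADMM iterations ($q=1,2,\dots$). (5) The ADMM iterates are R-linearly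 convergent: for some $C_0>0$ and $C\in[0,1)$, $$\left\|\begin{matrix} z^{q}(\cdot;\underline{x}_k)-z^*(\cdot;\underline{x}_k)\\ \mu^{q}(\cdot;\underline{x}_k)-\mu^*(\cdot;\underline{x}_k)\end{matrix}\right\|_{L^\infty}\le C_0C^q\left\|\begin{matrix} z^{0}(\cdot;\underline{x}_k)-z^*(\cdot;\underline{x}_k)\\ \mu^{0}(\cdot;\underline{x}_k)-\mu^*(\cdot;\underline{x}_k)\end{matrix}\right\|_{L^\infty}.$$ Then there exists a fixed number of iterations $\hat q>0$ such that, if the ADMM algorithm is run with $q_k=\hat q$ iterations in every MPC step $k$, then for all initial states $\underline{x}_0\in\Gamma_{\hat\alpha}$ the optimal cost $J^*(\underline{x}_k)$ and the error $\|\Delta x_F^{q_k}(\cdot;\underline{x}_k)\|_{L^\infty}$ decay exponentially in $k$, and the DMPC scheme stabilizes the origin exponentially, i.e. there are constants $\gamma_1,\gamma_2>0$ with $\|\underline{x}(t)\|\le\gamma_1e^{-\gamma_2t}$ for all $t\ge0$ along the closed loop.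
   Context: **Norms.** $\|\cdot\|$ is the Euclidean norm and $\|z\|_{L^\infty}:=\sup_{t\in[0,T]}\|z(t)\|$. For a set $S$ and $\sigma>0$, $S^\sigma$ is the $\sigma$-neighborhood $\{x:\ \|x-\tilde x\|\le\sigma\text{ for some }\tilde x\in S\}$ (for sets of functions, in the $L^\infty$-norm). $[a_j]_{j\in A}$ denotes stacking. **System.** Let $\mathcal{G}=(\mathcal{V},\mathcal{E})$ be a directed graph, $\mathcal{V}=\{1,\dots,N\}$, $\mathcal{N}_{i\leftarrow}=\{j:(j,i)\in\mathcal{E},\,j\ne i\}$. Subsystem $i$ has dynamics $\dot{\underline{x}}_i=f_i(\underline{x}_i,\underline{u}_i,[\underline{x}_j]_{j\in\mathcal{N}_{i\leftarrow}})$, with $\underline{x}_i\in\mathbb{R}^{n_i}$, $\underline{u}_i\in\mathbb{R}^{m_i}$; $p_i:=\sum_{j\in\mathcal{N}_{i\leftarrow}}n_j$, $p=\sum_ip_i$, $n=\sum_in_i$, $m=\sum_im_i$. In stacked form: $\dot{\underline{x}}=F(\underline{x},\underline{u})$, $F=[f_i]_{i\in\mathcal{V}}$, with $f_i(0,0,0)=0$. (Underlined symbols are plant variables, the others are MPC-internal.) **Centralized MPC problem.** Given $\underline{x}_k=\underline{x}(t_k)$, $t_k=k\Delta t$: minimize over $u$ $$J(u,\underline{x}_k)=V(x(T))+\int_0^Tl(x(\tau),u(\tau))\,d\tau\quad\text{s.t. }\dot x=F(x,u),\ x(0)=\underline{x}_k,\ u(\tau)\in U,$$ $V(x)=\sum_iV_i(x_i)$,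 $l(x,u)=\sum_il_i(x_i,u_i)$, $U=\prod_iU_i$ with $U_i$ compact and convex. The optimal solution is $(x^*,u^* )(\tau;\underline{x}_k)$, the optimal cost is $J^*(\underline{x}_k)$, and the optimal feedback law $\kappa^*$ is defined by $u^*(\tau;\underline{x}_k)=\kappa^*(x^*(\tau;\underline{x}_k);\underline{x}_k)$. Standing assumptions: there are $m_l,M_l>0$, $m_V,M_V\ge0$ with $m_l(\|x\|^2+\|u\|^2)\le l(x,u)\le M_l(\|x\|^2+\|u\|^2)$ and $m_V\|x\|^2\le V(x)\le M_V\|x\|^2$; the functions $f_i$, $V_i$, $l_i$ are continuously differentiable; every bounded control $u(t)\in U$, $t\in[0,T]$, yields a bounded state response; an optimal solution exists. **Level sets.** $\Gamma_\alpha=\{x\in\mathbb{R}^n: J^*(x)\le\alpha\}$ with $\alpha=\beta(1+\frac{m_l}{M_V}T)$, where $\beta$ is from hypothesis (1); similarly $\Gamma_{\hat\alpha}=\{x: J^*(x)\le\hat\alpha\}$. **ADMM.** Local copies $v_i=[v_{ji}]_{j\in\mathcal{N}_{i\leftarrow}}$ and coordination variables $z_i$ are introduced, with decoupled dynamics $\dot x_i=f_i(x_i,u_i,v_i)$, $x_i(0)=\underline{x}_{k,i}$, and consistency constraints $z_i-x_i=0$, $z_j-v_{ji}=0$ ($j\in\mathcal{N}_{i\leftarrow}$). Let $w=[(u_i,v_i)]_{i\in\mathcal{V}}$, $z=[z_i]_{i\in\mathcal{V}}$, $\mu=[\mu_i]_{i\in\mathcal{V}}$, $\mu_i=(\mu_{ii},[\mu_{ji}]_{j\in\mathcal{N}_{i\leftarrow}})$.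 Augmented Lagrangian (subject to the decoupled dynamics, $J$ evaluated along them): $$J_\rho(w,z,\mu;\underline{x}_k)=J(u;\underline{x}_k)+\sum_{i\in\mathcal{V}}\int_0^T\Big[\mu_{ii}^{T}(z_i-x_i)+\tfrac\rho2\|z_i-x_i\|^2+\sum_{j\in\mathcal{N}_{i\leftarrow}}\big(\mu_{ji}^{T}(z_j-v_{ji})+\tfrac\rho2\|z_j-v_{ji}\|^2\big)\Big]d\tau .$$ $(w^*,z^*,\mu^* )(\tau;\underline{x}_k)$ denotes the optimal (saddle point) triple. With $\mathcal{W}=\{(u,v)\in L^\infty_{m+p}(0,T): u(t)\in U\ \forall t\}$, iteration $q\ge1$ is: $w^q=\arg\min_{w\in\mathcal{W}}J_\rho(w,z^{q-1},\mu^{q-1};\underline{x}_k)$; $z^q=\arg\min_zJ_\rho(w^q,z,\mu^{q-1};\underline{x}_k)$; $\mu^q_{ii}=\mu^{q-1}_{ii}+\rho(z_i^q-x_i^q)$, $\mu^q_{ji}=\mu^{q-1}_{ji}+\rho(z_j^q-v_{ji}^q)$, where $x^q$ is the decoupled state belonging to $w^q$. (These steps separate over the agents $i$.) In MPC step $k$ the iteration is stopped after $q_k$ iterations. Initial trajectories $(z^0,\mu^0)$ are given for $k=0$; afterwards warm start: $\mu^0(\tau;\underline{x}_{k+1})=\mu^{q_k}(\tau;\underline{x}_k)$, $z^0(\tau;\underline{x}_{k+1})=z^{q_k}(\tau;\underline{x}_k)$. The feedback law $\kappa$ is defined by $u^{q_k}(\tau;\underline{x}_k)=\kappa(x^{q_k}(\tau;\underline{x}_k);z^{q_k-1},\mu^{q_k-1},\underline{x}_k)$,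 and $\kappa^*(\cdot;\underline{x}_k)=\kappa(\cdot;z^*,\mu^*,\underline{x}_k)$. $\mathcal{M}_\alpha:=\{\mu^*(\cdot;\underline{x}_k):\underline{x}_k\in\Gamma_\alpha\}$ and $\mathcal{Z}_\alpha:=\{z^*(\cdot;\underline{x}_k):\underline{x}_k\in\Gamma_\alpha\}$ are compact and non-empty. **Closed loop and error.** The plant input is $\underline{u}(t_k+\tau)=u^{q_k}(\tau;\underline{x}_k)$, $\tau\in[0,\Delta t)$. $x_F^{q_k}(\cdot;\underline{x}_k)$ solves $\dot x_F^{q_k}=F(x_F^{q_k},u^{q_k})$, $x_F^{q_k}(0)=\underline{x}_k$, on $[0,T]$. Thus $\underline{x}(t_k+\tau)=x_F^{q_k}(\tau;\underline{x}_k)$ for $\tau\in[0,\Delta t]$ and $\underline{x}_{k+1}=x_F^{q_k}(\Delta t;\underline{x}_k)$. The error is $\Delta x_F^{q_k}(\tau;\underline{x}_k):=x_F^{q_k}(\tau;\underline{x}_k)-x^*(\tau;\underline{x}_k)$, $\tau\in[0,T]$. **The value $\hat\alpha$.** $\hat\alpha(d,\Delta t)=\dfrac{m_J\,\alpha}{M_J\,(e^{\hat L\Delta t}+Dd)^2}$. Here $L_f,L_{\kappa^*},L_\kappa>0$ are finite Lipschitz constants of the dynamics $f=[f_i]_{i\in\mathcal{V}}$ (in $(x,u,v)$; also $\|F(x,u)\|\le L_f(\|x\|+\|u\|)$), of $\kappa^*$ (with $\|\kappa^*(x;\underline{x}_k)\|\le L_{\kappa^*}\|x\|$) and of $\kappa$,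 on the compact sets in which the trajectories involved evolve for $\underline{x}_k\in\Gamma_\alpha$; $\hat L=L_f(1+L_{\kappa^*})$; $m_J=\frac{m_l}{2\hat L}(1-e^{-2\hat LT})$, $M_J=M_Ve^{2\hat LT}+\frac{M_l}{2\hat L}(1+L_{\kappa^*}^2)(e^{2\hat LT}-1)$; $D=\frac{2\sqrt p}{\rho}NL_fTe^{L_f(1+\sqrt p)T}+K_1Te^{K_2T}$, $K_1=\big(L_f\frac{2\sqrt p}{\rho}+\frac{2L_\kappa}{1-C}\big)N$, $K_2=L_f(1+\sqrt p+L_\kappa)$. **Exponential decay** of a nonnegative sequence $(a_k)$ means $a_k\le c\,\theta^k$ for constants $c>0$, $\theta\in(0,1)$; here the constants (and $\gamma_1,\gamma_2$) are uniform over $\underline{x}_0\in\Gamma_{\hat\alpha}$. *)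

theory Defs
  imports "HOL-Analysis.Analysis"
begin

definition C1 :: "('x::real_normed_vector \<Rightarrow> 'y::real_normed_vector) \<Rightarrow> bool" where
  "C1 g \<longleftrightarrow> (\<exists>g'. (\<forall>x. (g has_derivative blinfun_apply (g' x)) (at x)) \<and> continuous_on UNIV g')"

definition C2 :: "('x::real_normed_vector \<Rightarrow> 'y::real_normed_vector) \<Rightarrow> bool" where
  "C2 g \<longleftrightarrow> (\<exists>g'. (\<forall>x. (g has_derivative blinfun_apply (g' x)) (at x)) \<and> C1 g')"

text \<open>Local Lipschitz continuity of \<open>g\<close> relative to \<open>A\<close>, for explicitly given distances: trajectories
  are plain functions here, so their distance is not the one of a metric space type.\<close>

definition loc_lipschitz ::
    "('x \<Rightarrow> 'x \<Rightarrow> real) \<Rightarrow> ('y \<Rightarrow> 'y \<Rightarrow> real) \<Rightarrow> 'x set \<Rightarrow> ('x \<Rightarrow> 'y) \<Rightarrow> bool" where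
  "loc_lipschitz d e A g \<longleftrightarrow>
     (\<forall>c\<in>A. \<exists>r>0. \<exists>L. \<forall>a\<in>A. \<forall>b\<in>A. d c a \<le> r \<and> d c b \<le> r \<longrightarrow> e (g a) (g b) \<le> L * d a b)"

definition Linf :: "real \<Rightarrow> 'y::euclidean_space set \<Rightarrow> (real \<Rightarrow> 'y) set" where
  "Linf T Y = {z. z \<in> borel_measurable (lebesgue_on {0..T}) \<and> bounded (z ` {0..T}) \<and>
                  (\<forall>t\<in>{0..T}. z t \<in> Y)}"

definition linf :: "real \<Rightarrow> (real \<Rightarrow> 'y::real_normed_vector) \<Rightarrow> real" where
  "linf T z = (SUP t\<in>{0..T}. norm (z t))"

definition linf_dist :: "real \<Rightarrow> (real \<Rightarrow> 'y::real_normed_vector) \<Rightarrow> (real \<Rightarrow> 'y) \<Rightarrow> real" where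
  "linf_dist T y z = linf T (\<lambda>t. y t - z t)"

text \<open>The sup-norm neighbourhood. The bound is written pointwise because \<open>linf\<close> carries no
  information for unbounded functions.\<close>

definition sigma_nbhd ::
    "real \<Rightarrow> 'y::euclidean_space set \<Rightarrow> real \<Rightarrow> (real \<Rightarrow> 'y) set \<Rightarrow> (real \<Rightarrow> 'y) set" where
  "sigma_nbhd T Y \<sigma> S = {z \<in> Linf T Y. \<exists>s\<in>S. \<forall>t\<in>{0..T}. norm (z t - s t) \<le> \<sigma>}"

text \<open>(Sequential) compactness in the sup norm on \<open>[0,T]\<close>.\<close>

definition sup_compact :: "real \<Rightarrow> (real \<Rightarrow> 'y::real_normed_vector) set \<Rightarrow> bool" where
  "sup_compact T S \<longleftrightarrow>
     (\<forall>s. (\<forall>j::nat. s j \<in> S) \<longrightarrow>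
        (\<exists>l\<in>S. \<exists>r. strict_mono r \<and> uniform_limit {0..T} (s \<circ> r) l sequentially))"

text \<open>Caratheodory solution on \<open>[0,T]\<close>; the case \<open>t = 0\<close> gives the initial condition.\<close>

definition ode_sol ::
    "real \<Rightarrow> (real \<Rightarrow> 'y::euclidean_space \<Rightarrow> 'y) \<Rightarrow> 'y \<Rightarrow> (real \<Rightarrow> 'y) \<Rightarrow> bool" where
  "ode_sol T g x0 x \<longleftrightarrow> continuous_on {0..T} x \<and>
     (\<forall>t\<in>{0..T}. ((\<lambda>s. g s (x s)) has_integral (x t - x0)) {0..t})"

definition uniform_exp_decay :: "'s set \<Rightarrow> ('s \<Rightarrow> nat \<Rightarrow> real) \<Rightarrow> bool" where
  "uniform_exp_decay S a \<longleftrightarrow> (\<exists>c>0. \<exists>\<theta>. 0 < \<theta> \<and> \<theta> < 1 \<and> (\<forall>s\<in>S. \<forall>k. a s k \<le> c * \<theta> ^ k))"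

text \<open>Agents form the finite type \<open>'a\<close>. The stacked state lives in \<open>real ^ 'n\<close>, and \<open>xown c\<close> is the
  agent to which the coordinate \<open>c\<close> belongs; similarly \<open>real ^ 'm\<close> and \<open>uown\<close> for the inputs. So the
  space of the \<open>i\<close>-th subsystem is the coordinate subspace of its own coordinates, and a vector of a
  subset of subsystems is a stacked vector padded with zeros. Functions attached to agent \<open>i\<close> are only
  ever evaluated at such padded vectors, and only the \<open>i\<close>-th block of the value of \<open>fdyn i\<close> is used.\<close>

record ('a, 'n, 'm) dmpc_problem =
  edges :: "('a \<times> 'a) set"
  xown :: "'n \<Rightarrow> 'a"
  uown :: "'m \<Rightarrow> 'a"
  fdyn :: "'a \<Rightarrow> real ^ 'n \<Rightarrow> real ^ 'm \<Rightarrow> real ^ 'n \<Rightarrow> real ^ 'n"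
  Vterm :: "'a \<Rightarrow> real ^ 'n \<Rightarrow> real"
  lterm :: "'a \<Rightarrow> real ^ 'n \<Rightarrow> real ^ 'm \<Rightarrow> real"
  Uset :: "'a \<Rightarrow> (real ^ 'm) set"
  horizon :: real
  penalty :: real
  sampling :: real

definition nbrs :: "('a, 'n::finite, 'm::finite) dmpc_problem \<Rightarrow> 'a \<Rightarrow> 'a set" where
  "nbrs P i = {j. (j, i) \<in> edges P \<and> j \<noteq> i}"

definition xdim :: "('a, 'n::finite, 'm::finite) dmpc_problem \<Rightarrow> 'a \<Rightarrow> nat" where
  "xdim P i = card {c. xown P c = i}"

definition pdim :: "('a::finite, 'n::finite, 'm::finite) dmpc_problem \<Rightarrow> nat" where
  "pdim P = (\<Sum>i\<in>UNIV. \<Sum>j\<in>nbrs P i. xdim P j)"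

definition xblk :: "('a, 'n::finite, 'm::finite) dmpc_problem \<Rightarrow> 'a set \<Rightarrow> real ^ 'n \<Rightarrow> real ^ 'n" where
  "xblk P S x = (\<chi> c. if xown P c \<in> S then x $ c else 0)"

definition ublk :: "('a, 'n::finite, 'm::finite) dmpc_problem \<Rightarrow> 'a \<Rightarrow> real ^ 'm \<Rightarrow> real ^ 'm" where
  "ublk P i u = (\<chi> c. if uown P c = i then u $ c else 0)"

text \<open>In \<open>v :: real ^ 'n ^ 'a\<close> the coordinate \<open>v $ i $ c\<close> with \<open>xown c = j\<close> belongs to the copy
  \<open>v\<^sub>j\<^sub>i\<close>; coordinates without a corresponding edge are zero on \<open>copy_space\<close>, whose dimension is \<open>pdim\<close>.
  The same layout is used for the multipliers \<open>\<mu>\<^sub>j\<^sub>i\<close>.\<close>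

definition copy_space :: "('a::finite, 'n::finite, 'm::finite) dmpc_problem \<Rightarrow> (real ^ 'n ^ 'a) set" where
  "copy_space P = {v. \<forall>i c. xown P c \<notin> nbrs P i \<longrightarrow> v $ i $ c = 0}"

definition copies :: "('a::finite, 'n::finite, 'm::finite) dmpc_problem \<Rightarrow> real ^ 'n \<Rightarrow> real ^ 'n ^ 'a" where
  "copies P x = (\<chi> i. xblk P (nbrs P i) x)"

definition dyn :: "('a::finite, 'n::finite, 'm::finite) dmpc_problem \<Rightarrow>
    real ^ 'n \<Rightarrow> real ^ 'm \<Rightarrow> real ^ 'n ^ 'a \<Rightarrow> real ^ 'n" where
  "dyn P x u v = (\<chi> c. let i = xown P c in
      fdyn P i (xblk P {i} x) (ublk P i u) (xblk P (nbrs P i) (v $ i)) $ c)"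

definition Fdyn :: "('a::finite, 'n::finite, 'm::finite) dmpc_problem \<Rightarrow>
    real ^ 'n \<Rightarrow> real ^ 'm \<Rightarrow> real ^ 'n" where
  "Fdyn P x u = dyn P x u (copies P x)"

definition Vfun :: "('a::finite, 'n::finite, 'm::finite) dmpc_problem \<Rightarrow> real ^ 'n \<Rightarrow> real" where
  "Vfun P x = (\<Sum>i\<in>UNIV. Vterm P i (xblk P {i} x))"

definition lfun :: "('a::finite, 'n::finite, 'm::finite) dmpc_problem \<Rightarrow>
    real ^ 'n \<Rightarrow> real ^ 'm \<Rightarrow> real" where
  "lfun P x u = (\<Sum>i\<in>UNIV. lterm P i (xblk P {i} x) (ublk P i u))"

definition Uall :: "('a::finite, 'n::finite, 'm::finite) dmpc_problem \<Rightarrow> (real ^ 'm) set" where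
  "Uall P = {u. \<forall>i. ublk P i u \<in> Uset P i}"

definition cost :: "('a::finite, 'n::finite, 'm::finite) dmpc_problem \<Rightarrow>
    (real \<Rightarrow> real ^ 'm) \<Rightarrow> (real \<Rightarrow> real ^ 'n) \<Rightarrow> real" where
  "cost P u x = Vfun P (x (horizon P)) + integral {0..horizon P} (\<lambda>\<tau>. lfun P (x \<tau>) (u \<tau>))"

definition plant_sol :: "('a::finite, 'n::finite, 'm::finite) dmpc_problem \<Rightarrow>
    real ^ 'n \<Rightarrow> (real \<Rightarrow> real ^ 'm) \<Rightarrow> (real \<Rightarrow> real ^ 'n) \<Rightarrow> bool" where
  "plant_sol P xk u x \<longleftrightarrow> ode_sol (horizon P) (\<lambda>\<tau> y. Fdyn P y (u \<tau>)) xk x"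

definition admissible :: "('a::finite, 'n::finite, 'm::finite) dmpc_problem \<Rightarrow>
    real ^ 'n \<Rightarrow> (real \<Rightarrow> real ^ 'm) \<Rightarrow> (real \<Rightarrow> real ^ 'n) \<Rightarrow> bool" where
  "admissible P xk u x \<longleftrightarrow> u \<in> Linf (horizon P) (Uall P) \<and> plant_sol P xk u x"

definition optimal_solution :: "('a::finite, 'n::finite, 'm::finite) dmpc_problem \<Rightarrow>
    real ^ 'n \<Rightarrow> (real \<Rightarrow> real ^ 'm) \<Rightarrow> (real \<Rightarrow> real ^ 'n) \<Rightarrow> bool" where
  "optimal_solution P xk u x \<longleftrightarrow> admissible P xk u x \<and>
     (\<forall>u' x'. admissible P xk u' x' \<longrightarrow> cost P u x \<le> cost P u' x')"

definition opt_cost :: "('a::finite, 'n::finite, 'm::finite) dmpc_problem \<Rightarrow> real ^ 'n \<Rightarrow> real" where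
  "opt_cost P xk = Inf {cost P u x | u x. admissible P xk u x}"

definition level_set :: "('a::finite, 'n::finite, 'm::finite) dmpc_problem \<Rightarrow> real \<Rightarrow> (real ^ 'n) set" where
  "level_set P a = {x. opt_cost P x \<le> a}"

definition standing_assumptions :: "('a::finite, 'n::finite, 'm::finite) dmpc_problem \<Rightarrow>
    real \<Rightarrow> real \<Rightarrow> real \<Rightarrow> real \<Rightarrow> bool" where
  "standing_assumptions P ml Ml mV MV \<longleftrightarrow>
     0 < horizon P \<and> 0 < penalty P \<and> 0 < sampling P \<and> sampling P \<le> horizon P \<and>
     0 < ml \<and> 0 < Ml \<and> 0 \<le> mV \<and> 0 \<le> MV \<and>
     (\<forall>x u. ml * ((norm x)\<^sup>2 + (norm u)\<^sup>2) \<le> lfun P x u \<and>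
            lfun P x u \<le> Ml * ((norm x)\<^sup>2 + (norm u)\<^sup>2)) \<and>
     (\<forall>x. mV * (norm x)\<^sup>2 \<le> Vfun P x \<and> Vfun P x \<le> MV * (norm x)\<^sup>2) \<and>
     dyn P 0 0 0 = 0 \<and>
     C1 (\<lambda>(x, u, v). dyn P x u v) \<and>
     (\<forall>i. C1 (\<lambda>x. Vterm P i (xblk P {i} x))) \<and>
     (\<forall>i. C1 (\<lambda>(x, u). lterm P i (xblk P {i} x) (ublk P i u))) \<and>
     (\<forall>i. compact (Uset P i) \<and> convex (Uset P i)) \<and>
     (\<forall>x0. \<forall>u \<in> Linf (horizon P) (Uall P). \<exists>x. plant_sol P x0 u x \<and> bounded (x ` {0..horizon P}))"

text \<open>Multipliers: the first component stacks \<open>\<mu>\<^sub>i\<^sub>i\<close>, the second one has the layout of the copies.\<close>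

type_synonym ('a, 'n) mult = "(real ^ 'n) \<times> (real ^ 'n ^ 'a)"

definition mult_space :: "('a::finite, 'n::finite, 'm::finite) dmpc_problem \<Rightarrow> ('a, 'n) mult set" where
  "mult_space P = UNIV \<times> copy_space P"

text \<open>\<open>w = (u, v) \<in> \<W>\<close> together with its decoupled state \<open>x\<close>. Minimization over \<open>w\<close> ranges over those
  \<open>w \<in> \<W>\<close> whose decoupled state exists on the whole horizon.\<close>

definition decoupled :: "('a::finite, 'n::finite, 'm::finite) dmpc_problem \<Rightarrow> real ^ 'n \<Rightarrow>
    (real \<Rightarrow> real ^ 'm) \<Rightarrow> (real \<Rightarrow> real ^ 'n ^ 'a) \<Rightarrow> (real \<Rightarrow> real ^ 'n) \<Rightarrow> bool" where
  "decoupled P xk u v x \<longleftrightarrow>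
     u \<in> Linf (horizon P) (Uall P) \<and> v \<in> Linf (horizon P) (copy_space P) \<and>
     ode_sol (horizon P) (\<lambda>\<tau> y. dyn P y (u \<tau>) (v \<tau>)) xk x"

definition aug_lagrangian :: "('a::finite, 'n::finite, 'm::finite) dmpc_problem \<Rightarrow>
    (real \<Rightarrow> real ^ 'm) \<Rightarrow> (real \<Rightarrow> real ^ 'n ^ 'a) \<Rightarrow> (real \<Rightarrow> real ^ 'n) \<Rightarrow>
    (real \<Rightarrow> real ^ 'n) \<Rightarrow> (real \<Rightarrow> ('a, 'n) mult) \<Rightarrow> real" where
  "aug_lagrangian P u v x z \<mu> = cost P u x +
     (\<Sum>i\<in>UNIV. integral {0..horizon P} (\<lambda>\<tau>.
        xblk P {i} (fst (\<mu> \<tau>)) \<bullet> xblk P {i} (z \<tau> - x \<tau>)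
        + penalty P / 2 * (norm (xblk P {i} (z \<tau> - x \<tau>)))\<^sup>2
        + (\<Sum>j\<in>nbrs P i.
             xblk P {j} (snd (\<mu> \<tau>) $ i) \<bullet> xblk P {j} (z \<tau> - v \<tau> $ i)
             + penalty P / 2 * (norm (xblk P {j} (z \<tau> - v \<tau> $ i)))\<^sup>2)))"

definition w_minimizer :: "('a::finite, 'n::finite, 'm::finite) dmpc_problem \<Rightarrow> real ^ 'n \<Rightarrow>
    (real \<Rightarrow> real ^ 'n) \<Rightarrow> (real \<Rightarrow> ('a, 'n) mult) \<Rightarrow>
    (real \<Rightarrow> real ^ 'm) \<Rightarrow> (real \<Rightarrow> real ^ 'n ^ 'a) \<Rightarrow> (real \<Rightarrow> real ^ 'n) \<Rightarrow> bool" where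
  "w_minimizer P xk z \<mu> u v x \<longleftrightarrow> decoupled P xk u v x \<and>
     (\<forall>u' v' x'. decoupled P xk u' v' x' \<longrightarrow>
        aug_lagrangian P u v x z \<mu> \<le> aug_lagrangian P u' v' x' z \<mu>)"

definition z_minimizer :: "('a::finite, 'n::finite, 'm::finite) dmpc_problem \<Rightarrow>
    (real \<Rightarrow> real ^ 'm) \<Rightarrow> (real \<Rightarrow> real ^ 'n ^ 'a) \<Rightarrow> (real \<Rightarrow> real ^ 'n) \<Rightarrow>
    (real \<Rightarrow> ('a, 'n) mult) \<Rightarrow> (real \<Rightarrow> real ^ 'n) \<Rightarrow> bool" where
  "z_minimizer P u v x \<mu> z \<longleftrightarrow> z \<in> Linf (horizon P) UNIV \<and>
     (\<forall>z' \<in> Linf (horizon P) UNIV. aug_lagrangian P u v x z \<mu> \<le> aug_lagrangian P u v x z' \<mu>)"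

definition mult_update :: "('a::finite, 'n::finite, 'm::finite) dmpc_problem \<Rightarrow>
    (real \<Rightarrow> real ^ 'n ^ 'a) \<Rightarrow> (real \<Rightarrow> real ^ 'n) \<Rightarrow> (real \<Rightarrow> real ^ 'n) \<Rightarrow>
    (real \<Rightarrow> ('a, 'n) mult) \<Rightarrow> (real \<Rightarrow> ('a, 'n) mult) \<Rightarrow> bool" where
  "mult_update P v x z \<mu> \<mu>' \<longleftrightarrow> (\<forall>\<tau>\<in>{0..horizon P}.
     \<mu>' \<tau> = \<mu> \<tau> + penalty P *\<^sub>R (z \<tau> - x \<tau>, copies P (z \<tau>) - v \<tau>))"

definition saddle_point :: "('a::finite, 'n::finite, 'm::finite) dmpc_problem \<Rightarrow> real ^ 'n \<Rightarrow>
    (real \<Rightarrow> real ^ 'm) \<Rightarrow> (real \<Rightarrow> real ^ 'n ^ 'a) \<Rightarrow> (real \<Rightarrow> real ^ 'n) \<Rightarrow>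
    (real \<Rightarrow> real ^ 'n) \<Rightarrow> (real \<Rightarrow> ('a, 'n) mult) \<Rightarrow> bool" where
  "saddle_point P xk u v x z \<mu> \<longleftrightarrow>
     (\<forall>\<mu>' \<in> Linf (horizon P) (mult_space P).
        aug_lagrangian P u v x z \<mu>' \<le> aug_lagrangian P u v x z \<mu>) \<and>
     (\<forall>u' v' x'. \<forall>z' \<in> Linf (horizon P) UNIV. decoupled P xk u' v' x' \<longrightarrow>
        aug_lagrangian P u v x z \<mu> \<le> aug_lagrangian P u' v' x' z' \<mu>)"

text \<open>The optimal primal trajectories satisfy the consistency constraints; requiring this pointwise
  selects the representative of the \<open>L\<^sup>\<infinity>\<close> class.\<close>

definition optimal_primal :: "('a::finite, 'n::finite, 'm::finite) dmpc_problem \<Rightarrow> real ^ 'n \<Rightarrow>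
    (real \<Rightarrow> real ^ 'm) \<Rightarrow> (real \<Rightarrow> real ^ 'n ^ 'a) \<Rightarrow> (real \<Rightarrow> real ^ 'n) \<Rightarrow>
    (real \<Rightarrow> real ^ 'n) \<Rightarrow> bool" where
  "optimal_primal P xk u v x z \<longleftrightarrow> optimal_solution P xk u x \<and>
     decoupled P xk u v x \<and> z \<in> Linf (horizon P) UNIV \<and>
     (\<forall>\<tau>\<in>{0..horizon P}. z \<tau> - x \<tau> = 0 \<and> copies P (z \<tau>) - v \<tau> = 0)"

definition stack_dist :: "real \<Rightarrow> (real \<Rightarrow> real ^ 'n::finite) \<Rightarrow> (real \<Rightarrow> ('a::finite, 'n) mult) \<Rightarrow>
    (real \<Rightarrow> real ^ 'n) \<Rightarrow> (real \<Rightarrow> ('a, 'n) mult) \<Rightarrow> real" where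
  "stack_dist T z \<mu> z' \<mu>' = linf T (\<lambda>\<tau>. (z \<tau> - z' \<tau>, \<mu> \<tau> - \<mu>' \<tau>))"

text \<open>Distance on the arguments of the suboptimal feedback law \<open>\<kappa>(x; z, \<mu>, x\<^sub>k)\<close>.\<close>

type_synonym ('a, 'n) kappa_arg =
  "(real ^ 'n) \<times> (real \<Rightarrow> real ^ 'n) \<times> (real \<Rightarrow> ('a, 'n) mult) \<times> (real ^ 'n)"

definition kappa_dist :: "real \<Rightarrow> ('a::finite, 'n::finite) kappa_arg \<Rightarrow> ('a, 'n) kappa_arg \<Rightarrow> real" where
  "kappa_dist T = (\<lambda>(x, z, \<mu>, y) (x', z', \<mu>', y').
     norm (x - x') + linf_dist T z z' + linf_dist T \<mu> \<mu>' + norm (y - y'))"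

text \<open>The first argument of the trajectories \<open>uit, vit, xit, zit, muit\<close> is the MPC step \<open>k\<close>, the second
  one the ADMM iteration \<open>q\<close>.\<close>

record ('a, 'n, 'm) dmpc_run =
  plant :: "real \<Rightarrow> real ^ 'n"
  uit :: "nat \<Rightarrow> nat \<Rightarrow> real \<Rightarrow> real ^ 'm"
  vit :: "nat \<Rightarrow> nat \<Rightarrow> real \<Rightarrow> real ^ 'n ^ 'a"
  xit :: "nat \<Rightarrow> nat \<Rightarrow> real \<Rightarrow> real ^ 'n"
  zit :: "nat \<Rightarrow> nat \<Rightarrow> real \<Rightarrow> real ^ 'n"
  muit :: "nat \<Rightarrow> nat \<Rightarrow> real \<Rightarrow> (real ^ 'n) \<times> (real ^ 'n ^ 'a)"
  xF :: "nat \<Rightarrow> real \<Rightarrow> real ^ 'n"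

definition mpc_state :: "('a::finite, 'n::finite, 'm::finite) dmpc_problem \<Rightarrow>
    ('a, 'n, 'm) dmpc_run \<Rightarrow> nat \<Rightarrow> real ^ 'n" where
  "mpc_state P r k = plant r (real k * sampling P)"

definition is_dmpc_run :: "('a::finite, 'n::finite, 'm::finite) dmpc_problem \<Rightarrow> (nat \<Rightarrow> nat) \<Rightarrow>
    (real \<Rightarrow> real ^ 'n) \<Rightarrow> (real \<Rightarrow> ('a, 'n) mult) \<Rightarrow> real ^ 'n \<Rightarrow> ('a, 'n, 'm) dmpc_run \<Rightarrow> bool" where
  "is_dmpc_run P qs z0 \<mu>0 x0 r \<longleftrightarrow>
     plant r 0 = x0 \<and>
     (\<forall>\<tau>\<in>{0..horizon P}. zit r 0 0 \<tau> = z0 \<tau> \<and> muit r 0 0 \<tau> = \<mu>0 \<tau>) \<and>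
     (\<forall>k. \<forall>\<tau>\<in>{0..horizon P}. zit r (Suc k) 0 \<tau> = zit r k (qs k) \<tau> \<and>
                            muit r (Suc k) 0 \<tau> = muit r k (qs k) \<tau>) \<and>
     (\<forall>k. zit r k 0 \<in> Linf (horizon P) UNIV \<and> muit r k 0 \<in> Linf (horizon P) (mult_space P)) \<and>
     (\<forall>k. \<forall>q\<in>{1..qs k}.
        w_minimizer P (mpc_state P r k) (zit r k (q - 1)) (muit r k (q - 1))
          (uit r k q) (vit r k q) (xit r k q) \<and>
        z_minimizer P (uit r k q) (vit r k q) (xit r k q) (muit r k (q - 1)) (zit r k q) \<and>
        mult_update P (vit r k q) (xit r k q) (zit r k q) (muit r k (q - 1)) (muit r k q)) \<and>
     (\<forall>k. plant_sol P (mpc_state P r k) (uit r k (qs k)) (xF r k)) \<and>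
     (\<forall>k. \<forall>\<tau>\<in>{0..sampling P}. plant r (real k * sampling P + \<tau>) = xF r k \<tau>)"

text \<open>Given the run \<open>R q x0\<close> for each fixed number \<open>q\<close> of iterations and each initial state \<open>x0\<close>: the
  steps \<open>k\<close> such that the closed-loop states up to and including step \<open>k\<close> lie in \<open>G\<close>.\<close>

definition steps_within :: "('a::finite, 'n::finite, 'm::finite) dmpc_problem \<Rightarrow>
    (nat \<Rightarrow> real ^ 'n \<Rightarrow> ('a, 'n, 'm) dmpc_run) \<Rightarrow> (real ^ 'n) set \<Rightarrow> (real ^ 'n) set \<Rightarrow>
    (nat \<times> (real ^ 'n) \<times> nat) set" where
  "steps_within P R G0 G =
     {(q, x0, k). 1 \<le> q \<and> x0 \<in> G0 \<and> (\<forall>j\<le>k. mpc_state P (R q x0) j \<in> G)}"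

definition L_hat :: "real \<Rightarrow> real \<Rightarrow> real" where
  "L_hat Lf Lks = Lf * (1 + Lks)"

definition m_J :: "real \<Rightarrow> real \<Rightarrow> real \<Rightarrow> real" where
  "m_J ml Lh T = ml / (2 * Lh) * (1 - exp (- 2 * Lh * T))"

definition M_J :: "real \<Rightarrow> real \<Rightarrow> real \<Rightarrow> real \<Rightarrow> real \<Rightarrow> real" where
  "M_J Ml MV Lks Lh T = MV * exp (2 * Lh * T) + Ml / (2 * Lh) * (1 + Lks\<^sup>2) * (exp (2 * Lh * T) - 1)"

definition D_const :: "('a::finite, 'n::finite, 'm::finite) dmpc_problem \<Rightarrow>
    real \<Rightarrow> real \<Rightarrow> real \<Rightarrow> real" where
  "D_const P Lf Lk C =
     (let T = horizon P; \<rho> = penalty P; N = real CARD('a); sp = sqrt (real (pdim P));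
          K1 = (Lf * (2 * sp / \<rho>) + 2 * Lk / (1 - C)) * N;
          K2 = Lf * (1 + sp + Lk)
      in 2 * sp / \<rho> * N * Lf * T * exp (Lf * (1 + sp) * T) + K1 * T * exp (K2 * T))"

definition alpha_hat :: "('a::finite, 'n::finite, 'm::finite) dmpc_problem \<Rightarrow>
    real \<Rightarrow> real \<Rightarrow> real \<Rightarrow> real \<Rightarrow> real \<Rightarrow> real \<Rightarrow> real \<Rightarrow> real \<Rightarrow> real \<Rightarrow> real" where
  "alpha_hat P ml Ml MV Lf Lks Lk C \<alpha> d =
     (let T = horizon P; Lh = L_hat Lf Lks
      in m_J ml Lh T * \<alpha> /
         (M_J Ml MV Lks Lh T * (exp (Lh * sampling P) + D_const P Lf Lk C * d)\<^sup>2))"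

end

theory Submission
  imports Defs
begin

text \<open>The optimal cost \<open>J\<close> is a Lyapunov function of the closed loop under the optimal controls, and the ADMM
iteration perturbs this loop by an amount that the number of iterations makes as small as desired
relative to the current deviation. So the closed loop is the interconnection of two contracting
systems with an arbitrarily small coupling in one direction, and a small-gain argument applies.

\<^bold>\<open>Decrease of the optimal cost.\<close> From a state of \<open>\<Omega>\<^sub>\<beta>\<close> the terminal controller pays for all running cost
by decreasing \<open>V\<close>. It is an arbitrary function, so the closed loop under it need not have a solution;
instead its value is sampled and held on short intervals, which loses only an arbitrarily small amount
of cost (\<open>sample_and_hold_step\<close>, \<open>approximate_terminal_descent\<close>). As an infimum, \<open>J\<close> does not see this
loss. It follows that optimal trajectories starting in \<open>\<Gamma>\<^sub>\<alpha>\<close> end in \<open>\<Omega>\<^sub>\<beta>\<close> (\<open>terminal_state_in_Omega\<close>) and,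
by prolonging the tail of an optimal trajectory inside \<open>\<Omega>\<^sub>\<beta>\<close>, that \<open>J\<close> decreases along it by at least
the running cost (\<open>opt_cost_decrease\<close>). As \<open>J\<close> is bounded above and below by multiples of \<open>\<parallel>x\<parallel>\<^sup>2\<close> on \<open>\<Gamma>\<^sub>\<alpha>\<close>,
one sampling interval multiplies it by a factor below one.

\<^bold>\<open>Perturbation by ADMM.\<close> Let \<open>s\<^sub>k\<close> be the sup-norm distance of the warm start \<open>(z\<^sup>0, \<mu>\<^sup>0)\<close> in step \<open>k\<close> from the
optimum \<open>(z\<^sup>*, \<mu>\<^sup>*)\<close> at \<open>x\<^sub>k\<close>. The multiplier update determines the decoupled state \<open>x\<^sup>q\<close> from \<open>z\<^sup>q\<close>, \<open>\<mu>\<^sup>q\<close> and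
\<open>\<mu>\<^sup>q\<^sup>-\<^sup>1\<close>, so its error is bounded by theirs (\<open>decoupled_state_error\<close>); Lipschitz continuity of \<open>\<kappa>\<close> passes this
on to the control, and Gronwall's inequality to the plant (\<open>plant_prediction_error\<close>). The error is thus at
most \<open>A C\<^sup>q\<^sup>-\<^sup>1 s\<^sub>k\<close>.

\<^bold>\<open>Small gain.\<close> Since \<open>J\<close> is twice continuously differentiable with minimum \<open>0\<close> at the origin, its increments are of
second order (\<open>C2_quadratic_increment\<close>), and \<open>y\<^sub>k = sqrt (J x\<^sub>k)\<close> satisfies
\<open>y\<^sub>k\<^sub>+\<^sub>1 \<le> \<theta> y\<^sub>k + c\<^sub>1 C\<^sup>q\<^sup>-\<^sup>1 s\<^sub>k\<close> with \<open>\<theta> < 1\<close>. By linear convergence, the warm start, and Lipschitz continuity of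
\<open>(z\<^sup>*, \<mu>\<^sup>*)\<close> in the state, \<open>s\<^sub>k\<^sub>+\<^sub>1 \<le> c\<^sub>2 C\<^sup>q\<^sup>-\<^sup>1 s\<^sub>k + c\<^sub>3 y\<^sub>k\<close>. A weighted sum of \<open>y\<close> and \<open>s\<close> then decays geometrically
once \<open>C\<^sup>q\<^sup>-\<^sup>1\<close> is small (\<open>coupled_decay\<close>). Both recursions hold only as long as the states stay in \<open>\<Gamma>\<^sub>\<alpha>\<close>; as
\<open>s\<^sub>0\<close> is bounded uniformly and \<open>\<alpha>\<^sub>h < \<alpha>\<close> (\<open>alpha_hat_less\<close>), a small weight on \<open>s\<close> keeps the weighted sum
below \<open>sqrt \<alpha>\<close>, which confines the states to \<open>\<Gamma>\<^sub>\<alpha>\<close>.\<close>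

section \<open>Integral inequalities\<close>

lemma gronwall:
  fixes \<phi> :: "real \<Rightarrow> real"
  assumes cont: "continuous_on {0..T} \<phi>" and B: "0 \<le> B"
    and le: "\<And>t. t \<in> {0..T} \<Longrightarrow> \<phi> t \<le> A + B * integral {0..t} \<phi>"
    and t: "t \<in> {0..T}"
  shows "\<phi> t \<le> A * exp (B * t)"
proof -
  let ?I = "\<lambda>s. integral {0..s} \<phi>"
  define g where "g s = (A + B * ?I s) * exp (- (B * s))" for s
  have dI: "(?I has_real_derivative \<phi> s) (at s within {0..T})" if "s \<in> {0..T}" for s
    by (rule integral_has_real_derivative[OF cont that])
  have cg: "continuous_on {0..t} g"
  proof -
    have "continuous_on {0..T} ?I"
      using dI by (meson DERIV_continuous continuous_on_eq_continuous_within)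
    then have "continuous_on {0..t} ?I" using t by (auto elim: continuous_on_subset)
    then show ?thesis unfolding g_def by (intro continuous_intros)
  qed
  have "g t \<le> g 0"
  proof (rule DERIV_nonpos_imp_decreasing_open[OF _ _ cg])
    show "0 \<le> t" using t by simp
    fix s assume s: "0 < s" "s < t"
    have "(?I has_real_derivative \<phi> s) (at s)"
      using dI[of s] at_within_Icc_at[of 0 s T] s t by simp
    then have "(g has_real_derivative
        ((A + B * ?I s) * (exp (- (B * s)) * (- B)) + (B * \<phi> s) * exp (- (B * s)))) (at s)"
      unfolding g_def by (auto intro!: derivative_eq_intros)
    moreover have "(A + B * ?I s) * (exp (- (B * s)) * (- B)) + (B * \<phi> s) * exp (- (B * s))
        = - (B * exp (- (B * s)) * (A + B * ?I s - \<phi> s))" by (simp add: algebra_simps)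
    moreover have "0 \<le> B * exp (- (B * s)) * (A + B * ?I s - \<phi> s)"
      using B le[of s] s t by (intro mult_nonneg_nonneg) auto
    ultimately show "\<exists>y. (g has_real_derivative y) (at s) \<and> y \<le> 0" by fastforce
  qed
  then have "A + B * ?I t \<le> A * exp (B * t)"
    by (simp add: g_def exp_minus field_simps)
  then show ?thesis using le[OF t] by linarith
qed

text \<open>The form in which Gronwall's inequality is applied to solutions of differential equations and to their
differences: controls are merely measurable, so the right-hand side \<open>w\<close> is only an integrand.\<close>

lemma gronwall_has_integral:
  fixes e w :: "real \<Rightarrow> 'y::euclidean_space"
  assumes cont: "continuous_on {0..T} e" and A: "0 \<le> A" and B: "0 \<le> B"
    and int: "\<And>t. t \<in> {0..T} \<Longrightarrow> (w has_integral (e t - e0)) {0..t}"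
    and le: "\<And>s. s \<in> {0..T} \<Longrightarrow> norm (w s) \<le> A + B * norm (e s)"
    and t: "t \<in> {0..T}"
  shows "norm (e t) \<le> (norm e0 + A * T) * exp (B * t)"
proof (rule gronwall[OF _ B _ t])
  show c: "continuous_on {0..T} (\<lambda>s. norm (e s))" by (intro continuous_intros cont)
  fix r assume r: "r \<in> {0..T}"
  have ci: "(\<lambda>s. norm (e s)) integrable_on {0..r}"
    using r by (intro integrable_continuous_real continuous_on_subset[OF c]) auto
  have "norm (e r - e0) \<le> integral {0..r} (\<lambda>s. A + B * norm (e s))"
    unfolding integral_unique[OF int[OF r], symmetric]
    using int[OF r] le r ci
    by (intro integral_norm_bound_integral integrable_add integrable_on_mult_right) auto
  also have "\<dots> = A * r + B * integral {0..r} (\<lambda>s. norm (e s))"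
    using r ci by (subst integral_add) (auto intro!: integrable_on_mult_right)
  also have "\<dots> \<le> A * T + B * integral {0..r} (\<lambda>s. norm (e s))"
    using r A by (simp add: mult_left_mono)
  finally show "norm (e r) \<le> norm e0 + A * T + B * integral {0..r} (\<lambda>s. norm (e s))"
    using norm_triangle_ineq2[of "e r" e0] by linarith
qed

text \<open>A field of at most linear growth moves the state away from the origin, and towards it, at most
exponentially. The lower bound on a short initial interval turns the running cost into a multiple of
\<open>\<parallel>x\<parallel>\<^sup>2\<close>: by the upper bound the state moves by at most \<open>\<parallel>x\<parallel> / 2\<close> there.\<close>

lemma linear_growth_bounds:
  fixes \<xi> w :: "real \<Rightarrow> 'y::euclidean_space"
  assumes L: "0 < L" and cont: "continuous_on {0..T} \<xi>"
    and int: "\<And>t. t \<in> {0..T} \<Longrightarrow> (w has_integral (\<xi> t - x)) {0..t}"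
    and le: "\<And>s. s \<in> {0..T} \<Longrightarrow> norm (w s) \<le> L * norm (\<xi> s)"
    and t: "t \<in> {0..T}"
  shows "norm (\<xi> t) \<le> exp (L * T) * norm x"
    and "t \<le> 1 / (2 * L * exp (L * T)) \<Longrightarrow> norm x / 2 \<le> norm (\<xi> t)"
proof -
  have up: "norm (\<xi> s) \<le> exp (L * T) * norm x" if s: "s \<in> {0..T}" for s
  proof -
    have "norm (\<xi> s) \<le> (norm x + 0 * T) * exp (L * s)"
      by (rule gronwall_has_integral[OF cont _ _ int _ s]) (use L le in auto)
    also have "\<dots> \<le> norm x * exp (L * T)" using L s by (simp add: mult_left_mono)
    finally show ?thesis by (simp add: mult.commute)
  qed
  show "norm (\<xi> t) \<le> exp (L * T) * norm x" by (rule up[OF t])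
  assume small: "t \<le> 1 / (2 * L * exp (L * T))"
  have "norm (\<xi> t - x) \<le> L * (exp (L * T) * norm x) * measure lborel (cbox 0 t)"
  proof (rule has_integral_bound[where f = w])
    fix s assume "s \<in> cbox 0 t"
    then have s: "s \<in> {0..T}" using t by simp
    show "norm (w s) \<le> L * (exp (L * T) * norm x)"
      using le[OF s] mult_left_mono[OF up[OF s], of L] L by linarith
  qed (use int[OF t] L in auto)
  also have "\<dots> = (t * (2 * L * exp (L * T))) * (norm x / 2)" using t by simp
  also have "\<dots> \<le> 1 * (norm x / 2)"
    using small L by (intro mult_right_mono) (auto simp: field_simps)
  finally show "norm x / 2 \<le> norm (\<xi> t)"
    using norm_triangle_ineq2[of x "\<xi> t"] by (simp add: norm_minus_commute)
qed

section \<open>Sup norms and Lipschitz constants on compact sets\<close>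

text \<open>The supremum \<open>linf\<close> is informative for bounded functions only, hence the boundedness assumption here
and wherever \<open>linf\<close> has to dominate pointwise values.\<close>

lemma norm_le_linf:
  assumes "bounded (z ` {0..T})" "t \<in> {0..T}"
  shows "norm (z t) \<le> linf T z"
proof -
  have "bdd_above ((\<lambda>t. norm (z t)) ` {0..T})"
    using assms(1) by (auto simp: bounded_iff bdd_above_def)
  then show ?thesis unfolding linf_def using assms(2) by (rule cSUP_upper2) auto
qed

lemma linf_le:
  assumes "0 \<le> T" "\<And>t. t \<in> {0..T} \<Longrightarrow> norm (z t) \<le> B"
  shows "linf T z \<le> B"
  unfolding linf_def using assms by (intro cSUP_least) auto

lemma bounded_diff_image:
  fixes y z :: "'a \<Rightarrow> 'b::real_normed_vector"
  assumes "bounded (y ` S)" "bounded (z ` S)"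
  shows "bounded ((\<lambda>t. y t - z t) ` S)"
proof -
  obtain a b where "\<forall>t\<in>S. norm (y t) \<le> a" "\<forall>t\<in>S. norm (z t) \<le> b"
    using assms by (auto simp: bounded_iff)
  then have "\<forall>t\<in>S. norm (y t - z t) \<le> a + b"
    by (meson add_mono norm_triangle_le_diff)
  then show ?thesis by (auto simp: bounded_iff)
qed

lemma bounded_Pair_image:
  assumes "bounded (f ` S)" "bounded (g ` S)"
  shows "bounded ((\<lambda>t. (f t, g t)) ` S)"
  by (rule bounded_subset[OF bounded_Times[OF assms]]) auto

text \<open>On a compact set a locally Lipschitz map is bounded and globally Lipschitz, even if the set is not
convex: a finite cover by Lipschitz balls gives a constant for pairs closer than some \<open>\<delta>\<close>, and for the
other pairs the bound on the values suffices. Both conclusions are stated pointwise in time.\<close>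

lemma loc_lipschitz_linf_compact:
  fixes g :: "'x::metric_space \<Rightarrow> real \<Rightarrow> 'y::real_normed_vector"
  assumes lip: "loc_lipschitz dist (linf_dist T) K g" and K: "compact K"
    and bd: "\<And>x. x \<in> K \<Longrightarrow> bounded (g x ` {0..T})"
  obtains B L where "0 \<le> B" "0 \<le> L"
    "\<And>x t. x \<in> K \<Longrightarrow> t \<in> {0..T} \<Longrightarrow> norm (g x t) \<le> B"
    "\<And>a b t. a \<in> K \<Longrightarrow> b \<in> K \<Longrightarrow> t \<in> {0..T} \<Longrightarrow> norm (g a t - g b t) \<le> L * dist a b"
proof -
  obtain r l where r: "\<And>c. c \<in> K \<Longrightarrow> 0 < r c"
    and l: "\<And>c a b. \<lbrakk>c \<in> K; a \<in> K; b \<in> K; dist c a \<le> r c; dist c b \<le> r c\<rbrakk>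
        \<Longrightarrow> linf_dist T (g a) (g b) \<le> l c * dist a b"
    using lip unfolding loc_lipschitz_def by metis
  have loc: "norm (g a t - g b t) \<le> \<bar>l c\<bar> * dist a b"
    if "c \<in> K" "a \<in> K" "b \<in> K" "dist c a \<le> r c" "dist c b \<le> r c" "t \<in> {0..T}" for a b c t
  proof -
    have "norm (g a t - g b t) \<le> linf_dist T (g a) (g b)"
      unfolding linf_dist_def using that bd
      by (intro norm_le_linf[where z = "\<lambda>t. g a t - g b t"] bounded_diff_image) auto
    also have "\<dots> \<le> l c * dist a b" using l that by blast
    also have "\<dots> \<le> \<bar>l c\<bar> * dist a b" by (intro mult_right_mono) auto
    finally show ?thesis .
  qed
  have rnn: "0 \<le> r c" if "c \<in> K" for c using r[OF that] by simp
  have "K \<subseteq> (\<Union>c\<in>K. ball c (r c / 2))" using r by force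
  then obtain D where D: "D \<subseteq> K" "finite D" "K \<subseteq> (\<Union>c\<in>D. ball c (r c / 2))"
    using compactE_image[OF K, of K "\<lambda>c. ball c (r c / 2)"] by auto
  obtain b where b: "\<And>c t. c \<in> K \<Longrightarrow> t \<in> {0..T} \<Longrightarrow> norm (g c t) \<le> b c"
    using bd unfolding bounded_iff by (metis image_eqI)
  define B where "B = (\<Sum>c\<in>D. \<bar>b c\<bar> + \<bar>l c\<bar> * r c)"
  define L0 where "L0 = (\<Sum>c\<in>D. \<bar>l c\<bar>)"
  \<comment> \<open>Points closer than \<open>\<delta>\<close> lie in a common ball of the cover, because that cover uses half the radii.\<close>
  define \<delta> where "\<delta> = Min (insert 1 ((\<lambda>c. r c / 2) ` D))"
  have \<delta>: "0 < \<delta>" "\<And>c. c \<in> D \<Longrightarrow> \<delta> \<le> r c / 2"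
  proof -
    show "0 < \<delta>" using D r unfolding \<delta>_def by (auto simp: subset_iff)
    show "\<delta> \<le> r c / 2" if "c \<in> D" for c
      unfolding \<delta>_def using D that by (intro Min_le) auto
  qed
  have B0: "0 \<le> B" "0 \<le> L0" unfolding B_def L0_def using r D
    by (auto intro!: sum_nonneg add_nonneg_nonneg mult_nonneg_nonneg rnn)
  have bdd: "norm (g x t) \<le> B" if x: "x \<in> K" and t: "t \<in> {0..T}" for x t
  proof -
    obtain c where c: "c \<in> D" "dist c x < r c / 2" using D x by auto
    have cK: "c \<in> K" using c D by auto
    have "norm (g x t) \<le> norm (g c t) + norm (g x t - g c t)"
      using norm_triangle_ineq[of "g c t" "g x t - g c t"] by simp
    also have "\<dots> \<le> \<bar>b c\<bar> + \<bar>l c\<bar> * dist x c"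
      using b[OF cK t] loc[of c x c t] c cK x t r[OF cK] by (intro add_mono) auto
    also have "\<dots> \<le> \<bar>b c\<bar> + \<bar>l c\<bar> * r c"
      using c r[OF cK] by (intro add_mono mult_left_mono) (auto simp: dist_commute)
    also have "\<dots> \<le> B" unfolding B_def
      using c D r by (intro member_le_sum) (auto intro!: add_nonneg_nonneg mult_nonneg_nonneg rnn)
    finally show ?thesis .
  qed
  have "norm (g x t - g y t) \<le> (L0 + 2 * B / \<delta>) * dist x y"
    if x: "x \<in> K" and y: "y \<in> K" and t: "t \<in> {0..T}" for x y t
  proof (cases "dist x y < \<delta>")
    case True
    obtain c where c: "c \<in> D" "dist c x < r c / 2" using D x by auto
    have cK: "c \<in> K" using c D by auto
    have "dist c y \<le> r c" using c \<delta>(2)[of c] True dist_triangle[of c y x] by linarith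
    then have "norm (g x t - g y t) \<le> \<bar>l c\<bar> * dist x y"
      using loc[of c x y t] c cK x y t r[OF cK] by simp
    also have "\<dots> \<le> (L0 + 2 * B / \<delta>) * dist x y"
    proof (intro mult_right_mono)
      have "\<bar>l c\<bar> \<le> L0" unfolding L0_def using c D by (intro member_le_sum) auto
      then show "\<bar>l c\<bar> \<le> L0 + 2 * B / \<delta>" using B0 \<delta> by (simp add: add_increasing2)
    qed auto
    finally show ?thesis .
  next
    case False
    have "norm (g x t - g y t) \<le> B + B"
      by (meson bdd[OF x t] bdd[OF y t] add_mono norm_triangle_le_diff)
    also have "\<dots> = (2 * B / \<delta>) * \<delta>" using \<delta> by simp
    also have "\<dots> \<le> (2 * B / \<delta>) * dist x y" using False B0 \<delta> by (intro mult_left_mono) auto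
    also have "\<dots> \<le> (L0 + 2 * B / \<delta>) * dist x y" using B0 by (intro mult_right_mono) auto
    finally show ?thesis .
  qed
  moreover have "0 \<le> L0 + 2 * B / \<delta>" using B0 \<delta> by simp
  ultimately show thesis using B0 bdd that by blast
qed

section \<open>Smooth functions\<close>

lemma C1_continuous:
  assumes "C1 g" shows "continuous_on UNIV g"
proof -
  obtain g' where "\<forall>x. (g has_derivative blinfun_apply (g' x)) (at x)"
    using assms unfolding C1_def by blast
  then show ?thesis
    by (meson continuous_at_imp_continuous_on has_derivative_continuous)
qed

lemma C2_continuous: "C2 f \<Longrightarrow> continuous_on UNIV f"
  unfolding C2_def by (meson continuous_at_imp_continuous_on has_derivative_continuous)

text \<open>The gradient vanishes at the minimum \<open>0\<close> and is Lipschitz on balls, so it is at most \<open>L \<parallel>z\<parallel>\<close> at \<open>z\<close>; the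
mean value inequality on a ball containing \<open>x\<close> and \<open>y\<close> does the rest.\<close>

lemma C2_quadratic_increment:
  fixes f :: "'x::euclidean_space \<Rightarrow> real"
  assumes C2: "C2 f" and f0: "f 0 = 0" and nonneg: "\<And>x. 0 \<le> f x"
  obtains L where "0 \<le> L"
    "\<And>x y. norm x \<le> R \<Longrightarrow> norm y \<le> R \<Longrightarrow> f y - f x \<le> L * (norm x + norm y) * norm (y - x)"
proof -
  obtain g' g'' where d1: "\<And>x. (f has_derivative blinfun_apply (g' x)) (at x)"
    and d2: "\<And>x. (g' has_derivative blinfun_apply (g'' x)) (at x)"
    and c2: "continuous_on UNIV g''"
    using C2 unfolding C2_def C1_def by metis
  have "blinfun_apply (g' 0) = (\<lambda>_. 0)"
    using has_derivative_local_min[OF d1, of 0] f0 nonneg by simp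
  then have g0: "g' 0 = 0" by (intro blinfun_eqI) simp
  have "compact (g'' ` cball 0 R)"
    by (intro compact_continuous_image continuous_on_subset[OF c2]) auto
  then have "bounded (g'' ` cball 0 R)" by (rule compact_imp_bounded)
  then obtain L0 where L0: "\<And>x. norm x \<le> R \<Longrightarrow> norm (g'' x) \<le> L0"
    unfolding bounded_iff by (metis imageI mem_cball_0)
  define L where "L = max L0 0"
  have lip: "norm (g' x) \<le> L * norm x" if "norm x \<le> R" for x
  proof -
    have "0 \<le> R" using that norm_ge_zero[of x] by linarith
    then have "norm (g' x - g' 0) \<le> L * norm (x - 0)" using that L0
      by (intro differentiable_bound[where S = "cball 0 R" and f' = "\<lambda>x. blinfun_apply (g'' x)"])
        (auto simp: norm_blinfun.rep_eq[symmetric] L_def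
          intro: has_derivative_at_withinI[OF d2] order_trans max.cobounded1)
    then show ?thesis using g0 by simp
  qed
  have "f y - f x \<le> L * (norm x + norm y) * norm (y - x)" if "norm x \<le> R" "norm y \<le> R" for x y
  proof -
    have mx: "max (norm x) (norm y) \<le> norm x + norm y" by simp
    have "norm (f y - f x) \<le> (L * (norm x + norm y)) * norm (y - x)"
    proof (rule differentiable_bound[where S = "cball 0 (max (norm x) (norm y))" and f' = "\<lambda>x. blinfun_apply (g' x)"])
      fix z assume "z \<in> cball (0::'x) (max (norm x) (norm y))"
      then have z: "norm z \<le> max (norm x) (norm y)" by simp
      then have "norm (g' z) \<le> L * norm z" using that by (intro lip) auto
      also have "\<dots> \<le> L * (norm x + norm y)" using order_trans[OF z mx] by (intro mult_left_mono) (auto simp: L_def)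
      finally show "onorm (blinfun_apply (g' z)) \<le> L * (norm x + norm y)" by (simp add: norm_blinfun.rep_eq)
    qed (auto intro: has_derivative_at_withinI[OF d1])
    then show ?thesis by simp
  qed
  moreover have "0 \<le> L" by (simp add: L_def)
  ultimately show thesis using that by blast
qed

section \<open>Decay of coupled sequences\<close>

lemma uniform_exp_decayI:
  assumes "0 < c" "0 < \<theta>" "\<theta> < 1" "\<And>s k. s \<in> S \<Longrightarrow> a s k \<le> c * \<theta> ^ k"
  shows "uniform_exp_decay S a"
  using assms unfolding uniform_exp_decay_def by blast

text \<open>Passing to square roots makes the recursion for the optimal cost linear. The constant is chosen such
that the square of the right-hand side dominates the bound on \<open>J\<close>; this needs a positive \<open>r\<close>.\<close>

lemma sqrt_perturbation:
  assumes "0 \<le> J" "0 \<le> E" "0 \<le> y" "0 \<le> L" "0 \<le> c" "0 < r" and J: "J \<le> r\<^sup>2 * y\<^sup>2 + L * (2 * c * y + E) * E"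
  shows "sqrt J \<le> r * y + (L * c / r + sqrt L) * E"
proof (rule real_le_lsqrt)
  define a s where "a = L * c / r" and "s = sqrt L"
  have as: "r * a = L * c" "s\<^sup>2 = L" "0 \<le> a" "0 \<le> s" using assms by (auto simp: a_def s_def)
  have "(r * y + (a + s) * E)\<^sup>2
      = (r\<^sup>2 * y\<^sup>2 + (2 * (r * a) * y * E + s\<^sup>2 * E\<^sup>2)) + (2 * r * y * s * E + (a\<^sup>2 + 2 * a * s) * E\<^sup>2)"
    by algebra
  moreover have "0 \<le> 2 * r * y * s * E + (a\<^sup>2 + 2 * a * s) * E\<^sup>2"
    using assms as by simp
  moreover have "L * (2 * c * y + E) * E = 2 * (r * a) * y * E + s\<^sup>2 * E\<^sup>2"
    unfolding as by algebra
  ultimately show "J \<le> (r * y + (L * c / r + sqrt L) * E)\<^sup>2"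
    using J unfolding a_def[symmetric] s_def[symmetric] by linarith
qed (use assms in auto)

text \<open>A small-gain argument for two sequences whose coupling from \<open>s\<close> to \<open>y\<close> carries the small factor \<open>\<eta>\<close>: the
weighted sum \<open>y + w s\<close> contracts. The recursions are only known while \<open>y\<close> has stayed below \<open>b\<close>, so the
contraction and this bound are established together, and the threshold \<open>\<epsilon>\<close> must not depend on the
sequences, because the initial state is still to vary when the number of iterations is fixed.\<close>

lemma coupled_decay:
  fixes \<theta> c1 c2 c3 a b S :: real
  assumes \<theta>: "0 \<le> \<theta>" "\<theta> < 1" and c: "0 \<le> c1" "0 \<le> c2" "0 \<le> c3"
    and ab: "a < b" "0 < b" and S: "0 \<le> S"
  obtains w r \<epsilon> where "0 < w" "0 < r" "r < 1" "0 < \<epsilon>"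
    "\<And>\<eta> y s k. \<lbrakk>0 \<le> \<eta>; \<eta> \<le> \<epsilon>; y 0 \<le> a; s 0 \<le> S; \<And>k. 0 \<le> y k;
       \<And>k. \<forall>j\<le>k. y j \<le> b \<Longrightarrow> 0 \<le> s k;
       \<And>k. \<forall>j\<le>k. y j \<le> b \<Longrightarrow> y (Suc k) \<le> \<theta> * y k + c1 * \<eta> * s k;
       \<And>k. \<forall>j\<le>Suc k. y j \<le> b \<Longrightarrow> s (Suc k) \<le> c2 * \<eta> * s k + c3 * y k\<rbrakk>
     \<Longrightarrow> y k \<le> b \<and> y k + w * s k \<le> b * r ^ k"
proof -
  define r where "r = (1 + \<theta>) / 2"
  \<comment> \<open>The first bound on the weight makes \<open>\<theta> + w c3 \<le> r\<close>, the second one makes the initial sum at most \<open>b\<close>.\<close>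
  define w where "w = min ((1 - \<theta>) / (2 * (c3 + 1))) ((b - a) / (S + 1))"
  \<comment> \<open>With this threshold, \<open>(c1 + w c2) \<eta> \<le> w r\<close>.\<close>
  define \<epsilon> where "\<epsilon> = w * r / (c1 + w * c2 + 1)"
  have r0: "0 < r" "r < 1" "\<theta> \<le> r" using \<theta> by (auto simp: r_def)
  have w0: "0 < w" using \<theta> c ab S by (simp add: w_def)
  have "w * (c3 + 1) \<le> (1 - \<theta>) / (2 * (c3 + 1)) * (c3 + 1)"
    using c by (intro mult_right_mono) (auto simp: w_def)
  also have "\<dots> = (1 - \<theta>) / 2" using c by (simp add: field_simps)
  finally have lc: "\<theta> + w * c3 \<le> r" using w0 by (simp add: r_def field_simps)
  have "w * (S + 1) \<le> (b - a) / (S + 1) * (S + 1)"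
    using S by (intro mult_right_mono) (auto simp: w_def)
  also have "\<dots> = b - a" using S by simp
  finally have lS: "a + w * S \<le> b" using w0 by (simp add: algebra_simps)
  have pos: "0 < c1 + w * c2 + 1" using c w0 by (simp add: add_nonneg_pos)
  have \<epsilon>: "0 < \<epsilon>" using w0 r0 pos by (simp add: \<epsilon>_def)
  have eq: "(c1 + w * c2 + 1) * \<epsilon> = w * r" using pos by (simp add: \<epsilon>_def)
  have main: "(\<forall>j\<le>k. y j \<le> b) \<and> y k + w * s k \<le> b * r ^ k"
    if \<eta>: "0 \<le> \<eta>" "\<eta> \<le> \<epsilon>" and init: "y 0 \<le> a" "s 0 \<le> S" and y0: "\<And>k. 0 \<le> y k"
      and s0: "\<And>k. \<forall>j\<le>k. y j \<le> b \<Longrightarrow> 0 \<le> s k"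
      and ys: "\<And>k. \<forall>j\<le>k. y j \<le> b \<Longrightarrow> y (Suc k) \<le> \<theta> * y k + c1 * \<eta> * s k"
      and ss: "\<And>k. \<forall>j\<le>Suc k. y j \<le> b \<Longrightarrow> s (Suc k) \<le> c2 * \<eta> * s k + c3 * y k"
    for \<eta> y s k
  proof (induction k)
    case 0
    have "w * s 0 \<le> w * S" using w0 init by simp
    then show ?case using init lS ab by simp
  next
    case (Suc k)
    have sk: "0 \<le> s k" using Suc s0 by blast
    have "(c1 + w * c2) * \<eta> \<le> (c1 + w * c2 + 1) * \<epsilon>" using \<eta> c w0 by (intro mult_mono) auto
    then have k1: "(c1 + w * c2) * \<eta> \<le> w * r" using eq by simp
    have "c1 * \<eta> \<le> (c1 + w * c2) * \<eta>" using \<eta> c w0 by (intro mult_right_mono) auto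
    then have k2: "c1 * \<eta> \<le> w * r" using k1 by linarith
    have step: "r * (y k + w * s k) \<le> b * r ^ Suc k"
      using Suc r0 by (simp add: mult.left_commute mult_left_mono)
    have "y (Suc k) \<le> \<theta> * y k + c1 * \<eta> * s k" using ys Suc by blast
    also have "\<dots> \<le> r * y k + w * r * s k"
      using r0 y0 k2 sk by (intro add_mono mult_right_mono) auto
    also have "\<dots> \<le> b * r ^ Suc k" using step by (simp add: algebra_simps)
    also have "\<dots> \<le> b" using r0 ab power_le_one[of r "Suc k"] mult_left_mono[of "r ^ Suc k" 1 b] by simp
    finally have yb: "\<forall>j\<le>Suc k. y j \<le> b" using Suc by (auto simp: le_Suc_eq)
    have "y (Suc k) + w * s (Suc k)
        \<le> (\<theta> * y k + c1 * \<eta> * s k) + w * (c2 * \<eta> * s k + c3 * y k)"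
      using ys[of k] ss[OF yb] Suc w0 by (intro add_mono mult_left_mono) auto
    also have "\<dots> = (\<theta> + w * c3) * y k + ((c1 + w * c2) * \<eta>) * s k" by (simp add: algebra_simps)
    also have "\<dots> \<le> r * y k + w * r * s k"
      using lc k1 y0 sk by (intro add_mono mult_right_mono) auto
    also have "\<dots> \<le> b * r ^ Suc k" using step by (simp add: algebra_simps)
    finally show ?case using yb by blast
  qed
  show thesis
    by (rule that[OF w0 r0(1,2) \<epsilon>]) (use main in blast)
qed

section \<open>Controlled trajectories\<close>

definition concat_at :: "real \<Rightarrow> (real \<Rightarrow> 'y) \<Rightarrow> (real \<Rightarrow> 'y) \<Rightarrow> real \<Rightarrow> 'y" where
  "concat_at s f g = (\<lambda>\<tau>. if \<tau> \<le> s then f \<tau> else g (\<tau> - s))"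

lemma concat_at_end: "\<eta> 0 = \<xi> s \<Longrightarrow> 0 \<le> t \<Longrightarrow> concat_at s \<xi> \<eta> (s + t) = \<eta> t"
  by (cases "t = 0") (auto simp: concat_at_def)

lemma has_integral_concat_at:
  fixes f g :: "real \<Rightarrow> 'y::euclidean_space"
  assumes f: "(f has_integral i) {0..s}" and g: "(g has_integral j) {0..t}"
    and "0 \<le> s" "0 \<le> t"
  shows "(concat_at s f g has_integral (i + j)) {0..s + t}"
proof (rule has_integral_combine[of 0 s])
  show "(concat_at s f g has_integral i) {0..s}"
    by (rule has_integral_eq[OF _ f]) (simp add: concat_at_def)
  have "((\<lambda>\<tau>. g (\<tau> - s)) has_integral j) {s..s + t}"
    using has_integral_shift_real_ivl[OF g, of "- s"] by (simp add: add.commute)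
  then show "(concat_at s f g has_integral j) {s..s + t}"
    by (rule has_integral_spike_finite[of "{s}", rotated 2]) (auto simp: concat_at_def)
qed (use assms in auto)

lemma has_integral_tail:
  fixes f :: "real \<Rightarrow> 'y::euclidean_space"
  assumes "(f has_integral i) {0..s}" "(f has_integral k) {0..s + r}" "0 \<le> s" "0 \<le> r"
  shows "((\<lambda>\<tau>. f (s + \<tau>)) has_integral (k - i)) {0..r}"
proof -
  have "f integrable_on {s..s + r}"
    by (rule integrable_subinterval_real[OF has_integral_integrable[OF assms(2)]]) (use assms(3,4) in auto)
  then have j: "(f has_integral (integral {s..s + r} f)) {s..s + r}" by (rule integrable_integral)
  have "(f has_integral (i + integral {s..s + r} f)) {0..s + r}"
    by (rule has_integral_combine[OF _ _ assms(1) j]) (use assms(3,4) in auto)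
  from has_integral_unique[OF assms(2) this] have "integral {s..s + r} f = k - i" by simp
  then show ?thesis using has_integral_shift_real_ivl[OF j, of s] by (simp add: add.commute)
qed

text \<open>Admissible controls are Lebesgue measurable on their interval. To cut and paste them, they are
extended by zero to the whole line, where translations preserve measurability.\<close>

lemma borel_measurable_lebesgue_shift:
  fixes f :: "real \<Rightarrow> 'y::euclidean_space"
  assumes "f \<in> borel_measurable lebesgue"
  shows "(\<lambda>x. f (x + c)) \<in> borel_measurable lebesgue"
proof -
  have "(\<lambda>x::real. c + (\<Sum>j\<in>Basis. (1 * (x \<bullet> j)) *\<^sub>R j)) \<in> lebesgue \<rightarrow>\<^sub>M lebesgue"
    by (rule lebesgue_affine_measurable) simp
  then have "(\<lambda>x::real. x + c) \<in> lebesgue \<rightarrow>\<^sub>M lebesgue" by (simp add: add.commute)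
  from measurable_compose[OF this assms] show ?thesis .
qed

lemma Linf_zero_extension:
  fixes u :: "real \<Rightarrow> 'y::euclidean_space"
  assumes "u \<in> Linf t Y"
  shows "(\<lambda>x. if x \<in> {0..t} then u x else 0) \<in> borel_measurable lebesgue"
  by (rule borel_measurable_if_I) (use assms in \<open>auto simp: Linf_def\<close>)

lemma Linf_concat_at:
  fixes u v :: "real \<Rightarrow> 'y::euclidean_space"
  assumes u: "u \<in> Linf s Y" and v: "v \<in> Linf t Y" and st: "0 \<le> s" "0 \<le> t"
  shows "concat_at s u v \<in> Linf (s + t) Y"
proof -
  let ?u = "\<lambda>x. if x \<in> {0..s} then u x else 0" and ?v = "\<lambda>x. if x \<in> {0..t} then v x else 0"
  have m: "?u \<in> borel_measurable lebesgue" "?v \<in> borel_measurable lebesgue"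
    using Linf_zero_extension[OF u] Linf_zero_extension[OF v] by auto
  have "(\<lambda>x. if x \<in> {..s} then ?u x else ?v (x + - s)) \<in> borel_measurable lebesgue"
    by (intro measurable_If_set m(1) borel_measurable_lebesgue_shift[OF m(2)]) auto
  then have "(\<lambda>x. if x \<in> {..s} then ?u x else ?v (x + - s)) \<in> borel_measurable (lebesgue_on {0..s + t})"
    by (rule measurable_restrict_space1)
  then have "concat_at s u v \<in> borel_measurable (lebesgue_on {0..s + t})"
    by (rule measurable_cong[THEN iffD1, rotated]) (auto simp: concat_at_def)
  moreover have "bounded (concat_at s u v ` {0..s + t})"
    by (rule bounded_subset[of "u ` {0..s} \<union> v ` {0..t}"]) (use u v in \<open>auto simp: Linf_def concat_at_def\<close>)
  ultimately show ?thesis using u v by (auto simp: Linf_def concat_at_def)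
qed

lemma Linf_tail:
  fixes u :: "real \<Rightarrow> 'y::euclidean_space"
  assumes u: "u \<in> Linf t Y" and s: "0 \<le> s" "s \<le> t"
  shows "(\<lambda>\<tau>. u (s + \<tau>)) \<in> Linf (t - s) Y"
proof -
  let ?u = "\<lambda>x. if x \<in> {0..t} then u x else 0"
  have "?u \<in> borel_measurable lebesgue"
    by (rule Linf_zero_extension[OF u])
  then have "(\<lambda>x. ?u (x + s)) \<in> borel_measurable (lebesgue_on {0..t - s})"
    by (intro measurable_restrict_space1 borel_measurable_lebesgue_shift)
  then have "(\<lambda>\<tau>. u (s + \<tau>)) \<in> borel_measurable (lebesgue_on {0..t - s})"
    by (rule measurable_cong[THEN iffD1, rotated]) (use s in \<open>auto simp: add.commute\<close>)
  moreover have "bounded ((\<lambda>\<tau>. u (s + \<tau>)) ` {0..t - s})"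
    by (rule bounded_subset[of "u ` {0..t}"]) (use u s in \<open>auto simp: Linf_def\<close>)
  ultimately show ?thesis using u s by (auto simp: Linf_def)
qed

lemma Linf_head:
  fixes u :: "real \<Rightarrow> 'y::euclidean_space"
  assumes u: "u \<in> Linf t Y" and s: "s \<le> t"
  shows "u \<in> Linf s Y"
proof -
  have "(\<lambda>x. if x \<in> {0..t} then u x else 0) \<in> borel_measurable lebesgue"
    by (rule Linf_zero_extension[OF u])
  then have "(\<lambda>x. if x \<in> {0..t} then u x else 0) \<in> borel_measurable (lebesgue_on {0..s})"
    by (rule measurable_restrict_space1)
  then have "u \<in> borel_measurable (lebesgue_on {0..s})"
    by (rule measurable_cong[THEN iffD1, rotated]) (use s in auto)
  then show ?thesis using u s unfolding Linf_def
    by (auto intro: bounded_subset[of "u ` {0..t}"])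
qed

lemma Linf_const: "c \<in> Y \<Longrightarrow> (\<lambda>_. c) \<in> Linf t Y"
  by (auto simp: Linf_def intro: bounded_subset[of "{c}"])

text \<open>Admissible pairs on an interval of arbitrary length: dynamic programming restricts, shifts and
concatenates them, whereas \<open>admissible\<close> is tied to the horizon.\<close>

definition traj :: "('a::finite, 'n::finite, 'm::finite) dmpc_problem \<Rightarrow> real \<Rightarrow>
    real ^ 'n \<Rightarrow> (real \<Rightarrow> real ^ 'm) \<Rightarrow> (real \<Rightarrow> real ^ 'n) \<Rightarrow> bool" where
  "traj P t x u \<xi> \<longleftrightarrow> u \<in> Linf t (Uall P) \<and> ode_sol t (\<lambda>\<tau> y. Fdyn P y (u \<tau>)) x \<xi>"

definition run_cost :: "('a::finite, 'n::finite, 'm::finite) dmpc_problem \<Rightarrow> real \<Rightarrow>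
    (real \<Rightarrow> real ^ 'm) \<Rightarrow> (real \<Rightarrow> real ^ 'n) \<Rightarrow> real" where
  "run_cost P t u \<xi> = integral {0..t} (\<lambda>\<tau>. lfun P (\<xi> \<tau>) (u \<tau>))"

lemma ode_sol_initial: "ode_sol t f x \<xi> \<Longrightarrow> 0 \<le> t \<Longrightarrow> \<xi> 0 = x"
proof -
  assume "ode_sol t f x \<xi>" "0 \<le> t"
  then have "((\<lambda>s. f s (\<xi> s)) has_integral (\<xi> 0 - x)) {0}"
    unfolding ode_sol_def by (metis atLeastAtMost_iff atLeastAtMost_singleton order_refl)
  from has_integral_unique[OF this has_integral_refl(2)] show "\<xi> 0 = x" by simp
qed

lemma traj_initial: "traj P t x u \<xi> \<Longrightarrow> 0 \<le> t \<Longrightarrow> \<xi> 0 = x"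
  unfolding traj_def using ode_sol_initial by blast

lemma traj_head: "traj P t x u \<xi> \<Longrightarrow> s \<le> t \<Longrightarrow> traj P s x u \<xi>"
  unfolding traj_def ode_sol_def by (auto intro: Linf_head elim: continuous_on_subset)

lemma traj_tail:
  assumes t: "traj P t x u \<xi>" and s: "0 \<le> s" "s \<le> t"
  shows "traj P (t - s) (\<xi> s) (\<lambda>\<tau>. u (s + \<tau>)) (\<lambda>\<tau>. \<xi> (s + \<tau>))"
  unfolding traj_def ode_sol_def
proof (intro conjI ballI)
  have c: "continuous_on {0..t} \<xi>" and u: "u \<in> Linf t (Uall P)"
    and i: "\<And>r. r \<in> {0..t} \<Longrightarrow> ((\<lambda>s. Fdyn P (\<xi> s) (u s)) has_integral (\<xi> r - x)) {0..r}"
    using t unfolding traj_def ode_sol_def by blast+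
  show "(\<lambda>\<tau>. u (s + \<tau>)) \<in> Linf (t - s) (Uall P)" by (rule Linf_tail[OF u s])
  show "continuous_on {0..t - s} (\<lambda>\<tau>. \<xi> (s + \<tau>))"
    by (rule continuous_on_compose2[OF c]) (use s in \<open>auto intro!: continuous_intros\<close>)
  fix r assume r: "r \<in> {0..t - s}"
  show "((\<lambda>\<tau>. Fdyn P (\<xi> (s + \<tau>)) (u (s + \<tau>))) has_integral \<xi> (s + r) - \<xi> s) {0..r}"
  proof -
    have "s \<in> {0..t}" "s + r \<in> {0..t}" using r s by auto
    from has_integral_tail[OF i[OF this(1)] i[OF this(2)] s(1)] show ?thesis using r by simp
  qed
qed

lemma traj_concat_at:
  assumes u: "traj P s x u \<xi>" and v: "traj P t (\<xi> s) v \<eta>" and st: "0 \<le> s" "0 \<le> t"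
  shows "traj P (s + t) x (concat_at s u v) (concat_at s \<xi> \<eta>)"
  unfolding traj_def ode_sol_def
proof (intro conjI ballI)
  have c1: "continuous_on {0..s} \<xi>" and ul1: "u \<in> Linf s (Uall P)"
    and i: "\<forall>r\<in>{0..s}. ((\<lambda>s. Fdyn P (\<xi> s) (u s)) has_integral (\<xi> r - x)) {0..r}"
    using u unfolding traj_def ode_sol_def by blast+
  have c2: "continuous_on {0..t} \<eta>" and ul2: "v \<in> Linf t (Uall P)"
    and j: "\<forall>r\<in>{0..t}. ((\<lambda>s. Fdyn P (\<eta> s) (v s)) has_integral (\<eta> r - \<xi> s)) {0..r}"
    using v unfolding traj_def ode_sol_def by blast+
  show "concat_at s u v \<in> Linf (s + t) (Uall P)" by (rule Linf_concat_at[OF ul1 ul2 st])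
  have e: "\<eta> 0 = \<xi> s" using traj_initial[OF v st(2)] .
  have "continuous_on ({0..s} \<union> {s..s + t}) (\<lambda>\<tau>. if \<tau> \<le> s then \<xi> \<tau> else \<eta> (\<tau> - s))"
  proof (rule continuous_on_cases_le)
    show "continuous_on {\<tau> \<in> {0..s} \<union> {s..s + t}. \<tau> \<le> s} \<xi>"
      by (rule continuous_on_subset[OF c1]) (use st in auto)
    show "continuous_on {\<tau> \<in> {0..s} \<union> {s..s + t}. s \<le> \<tau>} (\<lambda>\<tau>. \<eta> (\<tau> - s))"
      by (rule continuous_on_compose2[OF c2]) (use st in \<open>auto intro!: continuous_intros\<close>)
  qed (use e in \<open>auto intro: continuous_on_id\<close>)
  moreover have "{0..s} \<union> {s..s + t} = {0..s + t}" using st by auto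
  ultimately show "continuous_on {0..s + t} (concat_at s \<xi> \<eta>)" by (simp add: concat_at_def)
  fix r assume r: "r \<in> {0..s + t}"
  let ?F = "\<lambda>\<tau>. Fdyn P (concat_at s \<xi> \<eta> \<tau>) (concat_at s u v \<tau>)"
  have F: "?F = concat_at s (\<lambda>\<tau>. Fdyn P (\<xi> \<tau>) (u \<tau>)) (\<lambda>\<tau>. Fdyn P (\<eta> \<tau>) (v \<tau>))"
    by (auto simp: concat_at_def)
  show "(?F has_integral concat_at s \<xi> \<eta> r - x) {0..r}"
  proof (cases "r \<le> s")
    case True
    have "(?F has_integral \<xi> r - x) {0..r}"
      by (rule has_integral_eq[OF _ bspec[OF i]]) (use True r in \<open>auto simp: concat_at_def\<close>)
    then show ?thesis using True by (simp add: concat_at_def)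
  next
    case False
    then show ?thesis
      using has_integral_concat_at[OF bspec[OF i, of s] bspec[OF j, of "r - s"]] r st unfolding F by (simp add: concat_at_def)
  qed
qed

text \<open>A speed bound on the unit ball around the initial state is enough, since the trajectory cannot leave
this ball before time \<open>1 / M\<close>.\<close>

lemma traj_near_start:
  assumes tr: "traj P h x u \<xi>" and M: "0 \<le> M" "M * h < 1"
    and F: "\<And>y \<tau>. norm (y - x) \<le> 1 \<Longrightarrow> \<tau> \<in> {0..h} \<Longrightarrow> norm (Fdyn P y (u \<tau>)) \<le> M"
    and s: "s \<in> {0..h}"
  shows "norm (\<xi> s - x) \<le> M * s"
proof -
  have c: "continuous_on {0..h} \<xi>" and
    int: "\<forall>r\<in>{0..h}. ((\<lambda>s. Fdyn P (\<xi> s) (u s)) has_integral (\<xi> r - x)) {0..r}"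
    using tr unfolding traj_def ode_sol_def by blast+
  have drift: "norm (\<xi> r - x) \<le> M * r"
    if r: "r \<in> {0..h}" and lt: "\<And>q. 0 \<le> q \<Longrightarrow> q < r \<Longrightarrow> norm (\<xi> q - x) \<le> 1" for r
    using has_integral_bound_spike_finite[OF M(1), of "{r}" _ "\<xi> r - x" 0 r] bspec[OF int r] lt F r
    by (auto simp: mult.commute)
  have small: "norm (\<xi> r - x) < 1" if r: "r \<in> {0..h}" for r
  proof (rule ccontr)
    assume "\<not> norm (\<xi> r - x) < 1"
    \<comment> \<open>Consider the first time at which the distance \<open>1\<close> is reached; up to then the speed bound is valid.\<close>
    let ?S = "{q \<in> {0..h}. 1 \<le> norm (\<xi> q - x)}"
    have "closed {q \<in> {0..h}. norm (\<xi> q - x) \<in> {1..}}"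
      by (intro continuous_closed_preimage[unfolded vimage_def Int_def mem_Collect_eq] closed_atLeastAtMost)
        (auto intro!: continuous_intros c)
    then have "closed ?S" by simp
    moreover have "bounded ?S" by (rule bounded_subset[of "{0..h}"]) auto
    ultimately have "compact ?S" by (simp add: compact_eq_bounded_closed)
    moreover have "?S \<noteq> {}" using r \<open>\<not> norm (\<xi> r - x) < 1\<close> by auto
    ultimately obtain q where q: "q \<in> ?S" "\<And>q'. q' \<in> ?S \<Longrightarrow> q \<le> q'"
      using continuous_attains_inf[of ?S "\<lambda>q. q"] continuous_on_id by auto
    have "norm (\<xi> q - x) \<le> M * q"
    proof (rule drift)
      fix p assume "0 \<le> p" "p < q"
      then show "norm (\<xi> p - x) \<le> 1" using q(2)[of p] q(1) by force
    qed (use q in auto)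
    also have "\<dots> \<le> M * h" using q M by (intro mult_left_mono) auto
    finally show False using q M by auto
  qed
  show ?thesis by (rule drift[OF s]) (use small s in \<open>auto intro: less_imp_le\<close>)
qed

section \<open>The terminal controller and the optimal cost\<close>

lemma continuous_on_xblk: "continuous_on A (xblk P S)"
  unfolding xblk_def
proof (rule continuous_on_vec_lambda)
  fix c
  show "continuous_on A (\<lambda>x. if xown P c \<in> S then x $ c else 0)"
    by (cases "xown P c \<in> S") (simp_all add: continuous_on_component)
qed

lemma continuous_on_ublk: "continuous_on A (ublk P i)"
  unfolding ublk_def
proof (rule continuous_on_vec_lambda)
  fix c
  show "continuous_on A (\<lambda>x. if uown P c = i then x $ c else 0)"
    by (cases "uown P c = i") (simp_all add: continuous_on_component)
qed

lemma continuous_on_copies: "continuous_on A (copies P)"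
  unfolding copies_def by (intro continuous_on_vec_lambda continuous_on_xblk)

text \<open>The terminal feedback \<open>\<kappa>V\<close> is only a function: without continuity or measurability, a trajectory
generated by it need not exist.\<close>

locale terminal_controller =
  fixes P :: "('a::finite, 'n::finite, 'm::finite) dmpc_problem"
    and ml Ml mV MV \<beta> :: real and \<kappa>V :: "real ^ 'n \<Rightarrow> real ^ 'm"
  assumes standing: "standing_assumptions P ml Ml mV MV"
    and beta_pos: "0 < \<beta>"
    and Omega: "compact {x. Vfun P x \<le> \<beta>}"
    and kV: "\<And>x. Vfun P x \<le> \<beta> \<Longrightarrow> \<kappa>V x \<in> Uall P"
    and kV_decrease: "\<And>x. Vfun P x \<le> \<beta> \<Longrightarrow>
      frechet_derivative (Vfun P) (at x) (Fdyn P x (\<kappa>V x)) + lfun P x (\<kappa>V x) \<le> 0"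
begin

lemma horizon_pos: "0 < horizon P" and ml_pos: "0 < ml"
  using standing by (simp_all add: standing_assumptions_def)

lemma lfun_lower: "ml * ((norm x)\<^sup>2 + (norm u)\<^sup>2) \<le> lfun P x u"
  and lfun_upper: "lfun P x u \<le> Ml * ((norm x)\<^sup>2 + (norm u)\<^sup>2)"
  and Vfun_upper: "Vfun P x \<le> MV * (norm x)\<^sup>2"
  and Ml_pos: "0 < Ml"
  using standing by (simp_all add: standing_assumptions_def)

lemma lfun_lower_state: "ml * (norm x)\<^sup>2 \<le> lfun P x u"
proof -
  have "ml * (norm x)\<^sup>2 \<le> ml * ((norm x)\<^sup>2 + (norm u)\<^sup>2)"
    using ml_pos by (intro mult_left_mono) auto
  then show ?thesis using lfun_lower[of x u] by linarith
qed

lemma lfun_nonneg: "0 \<le> lfun P x u"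
  using lfun_lower_state[of x u] ml_pos by (meson less_imp_le mult_nonneg_nonneg order_trans zero_le_power2)

lemma Vfun_nonneg: "0 \<le> Vfun P x"
proof -
  have "0 \<le> mV" "mV * (norm x)\<^sup>2 \<le> Vfun P x" using standing by (simp_all add: standing_assumptions_def)
  then show ?thesis by (meson mult_nonneg_nonneg order_trans zero_le_power2)
qed

text \<open>Otherwise \<open>V\<close> would vanish identically and its sublevel set, the whole space, would be compact.\<close>

lemma MV_pos: "0 < MV"
proof (rule ccontr)
  assume "\<not> 0 < MV"
  then have "Vfun P x \<le> \<beta>" for x
    using Vfun_upper[of x] beta_pos mult_nonpos_nonneg[of MV "(norm x)\<^sup>2"] by simp
  then have "compact (UNIV :: (real ^ 'n) set)" using Omega by simp
  then show False using compact_imp_bounded not_bounded_UNIV by blast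
qed

lemma continuous_Fdyn: "continuous_on UNIV (\<lambda>p. Fdyn P (fst p) (snd p))"
proof -
  have "C1 (\<lambda>(x, u, v). dyn P x u v)" using standing by (simp add: standing_assumptions_def)
  have "continuous_on UNIV (\<lambda>p. (fst p, snd p, copies P (fst p)))"
    by (intro continuous_intros continuous_on_compose2[OF continuous_on_copies]) auto
  from continuous_on_compose2[OF C1_continuous[OF \<open>C1 _\<close>] this]
  show ?thesis unfolding Fdyn_def by simp
qed

lemma continuous_lfun: "continuous_on UNIV (\<lambda>p. lfun P (fst p) (snd p))"
proof -
  have "continuous_on UNIV (\<lambda>p. lterm P i (xblk P {i} (fst p)) (ublk P i (snd p)))" for i
  proof -
    have "C1 (\<lambda>(x, u). lterm P i (xblk P {i} x) (ublk P i u))"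
      using standing by (simp add: standing_assumptions_def)
    from C1_continuous[OF this] show ?thesis by (simp add: case_prod_beta)
  qed
  then show ?thesis unfolding lfun_def by (intro continuous_on_sum) auto
qed

lemma Vfun_derivative:
  obtains V' where "\<And>x. (Vfun P has_derivative blinfun_apply (V' x)) (at x)" "continuous_on UNIV V'"
proof -
  have "\<forall>i. \<exists>g'. (\<forall>x. ((\<lambda>x. Vterm P i (xblk P {i} x)) has_derivative blinfun_apply (g' x)) (at x))
      \<and> continuous_on UNIV g'"
    using standing by (simp add: standing_assumptions_def C1_def)
  then obtain g' where g: "\<And>i x. ((\<lambda>x. Vterm P i (xblk P {i} x)) has_derivative blinfun_apply (g' i x)) (at x)"
    and gc: "\<And>i. continuous_on UNIV (g' i)" by metis
  have "(Vfun P has_derivative blinfun_apply (\<Sum>i\<in>UNIV. g' i x)) (at x)" for x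
    unfolding Vfun_def[abs_def] blinfun.sum_left by (intro has_derivative_sum g)
  moreover have "continuous_on UNIV (\<lambda>x. \<Sum>i\<in>UNIV. g' i x)" by (intro continuous_on_sum gc)
  ultimately show thesis by (rule that)
qed

lemma compact_Uall: "compact (Uall P)"
proof -
  have cU: "\<And>i. compact (Uset P i)" using standing by (simp add: standing_assumptions_def)
  have "closed (\<Inter>i. ublk P i -` Uset P i)"
    by (intro closed_INT ballI continuous_closed_vimage compact_imp_closed cU)
      (metis continuous_on_ublk UNIV_I continuous_on_eq_continuous_at open_UNIV)
  moreover have "(\<Inter>i. ublk P i -` Uset P i) = Uall P" by (auto simp: Uall_def)
  ultimately have cl: "closed (Uall P)" by simp
  obtain b where b: "\<And>i u. u \<in> Uset P i \<Longrightarrow> norm u \<le> b i"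
    using compact_imp_bounded[OF cU] unfolding bounded_iff by metis
  have "norm u \<le> (\<Sum>c\<in>UNIV. b (uown P c))" if "u \<in> Uall P" for u
  proof -
    have "norm u \<le> (\<Sum>c\<in>UNIV. \<bar>u $ c\<bar>)" by (rule norm_le_l1_cart)
    also have "\<dots> \<le> (\<Sum>c\<in>UNIV. b (uown P c))"
    proof (rule sum_mono)
      fix c
      have "\<bar>u $ c\<bar> = \<bar>ublk P (uown P c) u $ c\<bar>" by (simp add: ublk_def)
      also have "\<dots> \<le> norm (ublk P (uown P c) u)" by (rule component_le_norm_cart)
      also have "\<dots> \<le> b (uown P c)" using that b by (simp add: Uall_def)
      finally show "\<bar>u $ c\<bar> \<le> b (uown P c)" .
    qed
    finally show ?thesis .
  qed
  then have "bounded (Uall P)" unfolding bounded_iff by blast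
  then show ?thesis using cl compact_eq_bounded_closed by blast
qed

lemma run_cost_integrable:
  assumes "traj P t x u \<xi>"
  shows "(\<lambda>\<tau>. lfun P (\<xi> \<tau>) (u \<tau>)) integrable_on {0..t}"
proof -
  have c: "continuous_on {0..t} \<xi>" and u: "u \<in> Linf t (Uall P)"
    using assms unfolding traj_def ode_sol_def by blast+
  have um: "u \<in> borel_measurable (lebesgue_on {0..t})" using u by (simp add: Linf_def)
  have xm: "\<xi> \<in> borel_measurable (lebesgue_on {0..t})"
    by (rule continuous_imp_measurable_on_sets_lebesgue[OF c]) auto
  obtain b where b: "\<And>\<tau>. \<tau> \<in> {0..t} \<Longrightarrow> norm (\<xi> \<tau>) \<le> b"
    using compact_imp_bounded[OF compact_continuous_image[OF c compact_Icc]] unfolding bounded_iff by (metis imageI)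
  obtain d where d: "\<And>\<tau>. \<tau> \<in> {0..t} \<Longrightarrow> norm (u \<tau>) \<le> d"
    using u unfolding Linf_def bounded_iff by blast
  have m: "(\<lambda>\<tau>. lfun P (fst (\<xi> \<tau>, u \<tau>)) (snd (\<xi> \<tau>, u \<tau>))) \<in> borel_measurable (lebesgue_on {0..t})"
    by (rule borel_measurable_continuous_on[OF continuous_lfun]) (intro borel_measurable_Pair xm um)
  show ?thesis
  proof (rule measurable_bounded_by_integrable_imp_integrable[where g = "\<lambda>_. Ml * (b\<^sup>2 + d\<^sup>2)"])
    fix \<tau> assume t: "\<tau> \<in> {0..t}"
    have "lfun P (\<xi> \<tau>) (u \<tau>) \<le> Ml * ((norm (\<xi> \<tau>))\<^sup>2 + (norm (u \<tau>))\<^sup>2)" by (rule lfun_upper)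
    also have "\<dots> \<le> Ml * (b\<^sup>2 + d\<^sup>2)"
      using b[OF t] d[OF t] Ml_pos by (intro mult_left_mono add_mono power_mono) auto
    finally show "norm (lfun P (\<xi> \<tau>) (u \<tau>)) \<le> Ml * (b\<^sup>2 + d\<^sup>2)" using lfun_nonneg by simp
  qed (use m in auto)
qed



lemma run_cost_nonneg:
  assumes "traj P t x u \<xi>" shows "0 \<le> run_cost P t u \<xi>"
  unfolding run_cost_def by (intro integral_nonneg run_cost_integrable[OF assms] lfun_nonneg)

lemma run_cost_concat_at:
  assumes "traj P s x u \<xi>" "traj P t y v \<eta>" "0 \<le> s" "0 \<le> t"
  shows "run_cost P (s + t) (concat_at s u v) (concat_at s \<xi> \<eta>) = run_cost P s u \<xi> + run_cost P t v \<eta>"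
proof -
  have "(\<lambda>\<tau>. lfun P (concat_at s \<xi> \<eta> \<tau>) (concat_at s u v \<tau>))
      = concat_at s (\<lambda>\<tau>. lfun P (\<xi> \<tau>) (u \<tau>)) (\<lambda>\<tau>. lfun P (\<eta> \<tau>) (v \<tau>))"
    by (auto simp: concat_at_def)
  then show ?thesis unfolding run_cost_def
    using has_integral_concat_at[OF integrable_integral[OF run_cost_integrable[OF assms(1)]]
        integrable_integral[OF run_cost_integrable[OF assms(2)]] assms(3,4)]
    by (simp add: integral_unique)
qed

lemma run_cost_tail:
  assumes tr: "traj P t x u \<xi>" and s: "0 \<le> s" "s \<le> t"
  shows "run_cost P t u \<xi> = run_cost P s u \<xi> + run_cost P (t - s) (\<lambda>\<tau>. u (s + \<tau>)) (\<lambda>\<tau>. \<xi> (s + \<tau>))"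
proof -
  let ?l = "\<lambda>\<tau>. lfun P (\<xi> \<tau>) (u \<tau>)"
  have "(?l has_integral run_cost P t u \<xi>) {0..t}"
    unfolding run_cost_def by (rule integrable_integral[OF run_cost_integrable[OF tr]])
  then have whole: "(?l has_integral run_cost P t u \<xi>) {0..s + (t - s)}" by simp
  have head: "(?l has_integral run_cost P s u \<xi>) {0..s}"
    unfolding run_cost_def by (rule integrable_integral[OF run_cost_integrable[OF traj_head[OF tr s(2)]]])
  have "((\<lambda>\<tau>. ?l (s + \<tau>)) has_integral run_cost P t u \<xi> - run_cost P s u \<xi>) {0..t - s}"
    by (rule has_integral_tail[OF head whole s(1)]) (use s in simp)
  from integral_unique[OF this] show ?thesis by (simp add: run_cost_def[of P "t - s"])
qed

lemma run_cost_lower: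
  assumes tr: "traj P t x u \<xi>" and h: "0 \<le> h" "h \<le> t" and b: "0 \<le> b"
    and le: "\<And>\<tau>. \<tau> \<in> {0..h} \<Longrightarrow> b \<le> norm (\<xi> \<tau>)"
  shows "h * ml * b\<^sup>2 \<le> run_cost P t u \<xi>"
proof -
  have l: "ml * b\<^sup>2 \<le> lfun P (\<xi> \<tau>) (u \<tau>)" if "\<tau> \<in> {0..h}" for \<tau>
  proof -
    have "ml * b\<^sup>2 \<le> ml * (norm (\<xi> \<tau>))\<^sup>2"
      using le[OF that] b ml_pos by (intro mult_left_mono power_mono) auto
    then show ?thesis using lfun_lower_state[of "\<xi> \<tau>" "u \<tau>"] by linarith
  qed
  have i: "((\<lambda>\<tau>. lfun P (\<xi> \<tau>) (u \<tau>)) has_integral run_cost P h u \<xi>) {0..h}"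
    unfolding run_cost_def by (rule integrable_integral[OF run_cost_integrable[OF traj_head[OF tr h(2)]]])
  have "measure lborel {0..h} *\<^sub>R (ml * b\<^sup>2) \<le> run_cost P h u \<xi>"
    by (rule has_integral_le[OF has_integral_const_real i l])
  then have "h * ml * b\<^sup>2 \<le> run_cost P h u \<xi>" using h by (simp add: mult.assoc)
  then show ?thesis
    using run_cost_tail[OF tr h] run_cost_nonneg[OF traj_tail[OF tr h]] by linarith
qed

text \<open>Holding the control \<open>\<kappa>V x\<close> for a short time changes \<open>dV/dt + l\<close> by an amount that is small uniformly
over the compact set \<open>\<Omega>\<^sub>\<beta>\<close>, as this expression is a uniformly continuous function of state and control.
The trajectory also stays in \<open>\<Omega>\<^sub>\<beta>\<close>, so that steps can be iterated: far inside, \<open>V\<close> has room to grow for a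
short time; near the boundary the state is away from the origin, and there the running cost is at
least as large as the perturbation.\<close>

lemma sample_and_hold_step:
  assumes "0 < \<epsilon>"
  obtains \<delta> where "0 < \<delta>"
    "\<And>x h. \<lbrakk>Vfun P x \<le> \<beta>; 0 \<le> h; h \<le> \<delta>\<rbrakk> \<Longrightarrow> \<exists>u \<xi>. traj P h x u \<xi> \<and> Vfun P (\<xi> h) \<le> \<beta> \<and>
       Vfun P (\<xi> h) + run_cost P h u \<xi> \<le> Vfun P x + \<epsilon> * h"
proof -
  obtain V' where V': "\<And>x. (Vfun P has_derivative blinfun_apply (V' x)) (at x)"
    and V'c: "continuous_on UNIV V'" using Vfun_derivative by metis
  obtain R where R: "\<And>x. Vfun P x \<le> \<beta> \<Longrightarrow> norm x \<le> R"
    using compact_imp_bounded[OF Omega] unfolding bounded_iff by auto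
  \<comment> \<open>The margin \<open>1\<close> leaves room for the trajectories that start in \<open>\<Omega>\<^sub>\<beta>\<close>.\<close>
  define K where "K = cball (0 :: real ^ 'n) (R + 1) \<times> Uall P"
  have K: "compact K" unfolding K_def by (intro compact_Times compact_Uall compact_cball)
  define G where "G p = blinfun_apply (V' (fst p)) (Fdyn P (fst p) (snd p)) + lfun P (fst p) (snd p)" for p
  have Gc: "continuous_on K G" unfolding G_def
    by (intro continuous_intros continuous_on_subset[OF continuous_Fdyn]
        continuous_on_subset[OF continuous_lfun] continuous_on_compose2[OF V'c]) auto
  obtain M0 where M0: "\<And>p. p \<in> K \<Longrightarrow> norm (Fdyn P (fst p) (snd p)) \<le> M0"
    using compact_imp_bounded[OF compact_continuous_image[OF continuous_on_subset[OF continuous_Fdyn subset_UNIV] K]]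
    unfolding bounded_iff by (metis imageI)
  define M where "M = max 1 M0"
  have M: "1 \<le> M" "\<And>p. p \<in> K \<Longrightarrow> norm (Fdyn P (fst p) (snd p)) \<le> M"
    using M0 by (force simp: M_def)+
  \<comment> \<open>States with \<open>V x > \<beta> / 2\<close> have norm at least \<open>r\<close>, and after a step still norm at least \<open>r / 2\<close>.\<close>
  define r where "r = sqrt (\<beta> / (2 * MV))"
  have r: "0 < r" "r\<^sup>2 = \<beta> / (2 * MV)" using beta_pos MV_pos by (auto simp: r_def)
  \<comment> \<open>A perturbation of size \<open>e\<close> does not exceed the running cost at states of norm at least \<open>r / 2\<close>.\<close>
  define e where "e = min \<epsilon> (ml * (r / 2)\<^sup>2)"
  have e: "0 < e" "e \<le> \<epsilon>" "e \<le> ml * (r / 2)\<^sup>2" using assms ml_pos r by (auto simp: e_def)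
  obtain d where d: "0 < d" "\<And>p q. p \<in> K \<Longrightarrow> q \<in> K \<Longrightarrow> dist q p < d \<Longrightarrow> dist (G q) (G p) < e"
    using compact_uniformly_continuous[OF Gc K] e(1) unfolding uniformly_continuous_on_def by metis
  define \<delta> where "\<delta> = min (horizon P) (min (1 / (2 * M)) (min (d / (2 * M)) (min (r / (2 * M)) (\<beta> / (2 * e)))))"
  have \<delta>: "0 < \<delta>" using horizon_pos M d r beta_pos e by (simp add: \<delta>_def)
  have "\<exists>u \<xi>. traj P h x u \<xi> \<and> Vfun P (\<xi> h) \<le> \<beta> \<and> Vfun P (\<xi> h) + run_cost P h u \<xi> \<le> Vfun P x + \<epsilon> * h"
    if x: "Vfun P x \<le> \<beta>" and h: "0 \<le> h" "h \<le> \<delta>" for x h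
  proof -
    define c where "c = \<kappa>V x"
    have c: "c \<in> Uall P" using kV[OF x] by (simp add: c_def)
    have "h \<le> horizon P" "h \<le> 1 / (2 * M)" "h \<le> d / (2 * M)" "h \<le> r / (2 * M)" "h \<le> \<beta> / (2 * e)"
      using h by (auto simp: \<delta>_def)
    then have hb: "h \<le> horizon P" "M * h < 1" "M * h < d" "M * h \<le> r / 2" "e * h \<le> \<beta> / 2"
      using M(1) e(1) d(1) by (auto simp: field_simps)
    obtain \<xi> where "plant_sol P x (\<lambda>_. c) \<xi>"
      using standing Linf_const[OF c, of "horizon P"] unfolding standing_assumptions_def by blast
    then have tr: "traj P h x (\<lambda>_. c) \<xi>"
      using traj_head[of P "horizon P" x "\<lambda>_. c" \<xi> h] hb(1) Linf_const[OF c]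
      unfolding traj_def plant_sol_def by blast
    have nx: "norm x \<le> R" by (rule R[OF x])
    have inK: "(y, c) \<in> K" if "norm (y - x) \<le> 1" for y
      using that nx c norm_triangle_ineq2[of y x] by (simp add: K_def)
    have near: "norm (\<xi> s - x) \<le> M * h" if s: "s \<in> {0..h}" for s
    proof -
      have "norm (\<xi> s - x) \<le> M * s"
        by (rule traj_near_start[OF tr _ hb(2) _ s]) (use M inK in force)+
      also have "\<dots> \<le> M * h" using s M by (intro mult_left_mono) auto
      finally show ?thesis .
    qed
    have near1: "norm (\<xi> s - x) \<le> 1" if "s \<in> {0..h}" for s using near[OF that] hb by linarith
    have cx: "continuous_on {0..h} \<xi>" and
      int: "\<forall>s\<in>{0..h}. ((\<lambda>s. Fdyn P (\<xi> s) c) has_integral (\<xi> s - x)) {0..s}"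
      using tr unfolding traj_def ode_sol_def by blast+
    have cF: "continuous_on {0..h} (\<lambda>s. Fdyn P (\<xi> s) c)"
    proof -
      have "continuous_on {0..h} (\<lambda>s. (\<xi> s, c))" by (intro continuous_intros cx)
      from continuous_on_compose2[OF continuous_Fdyn this] show ?thesis by simp
    qed
    have dx: "(\<xi> has_vector_derivative Fdyn P (\<xi> s) c) (at s within {0..h})" if s: "s \<in> {0..h}" for s
    proof (rule has_vector_derivative_transform[OF s])
      show "((\<lambda>t. x + integral {0..t} (\<lambda>s. Fdyn P (\<xi> s) c)) has_vector_derivative Fdyn P (\<xi> s) c) (at s within {0..h})"
        using integral_has_vector_derivative[OF cF s] by (auto intro!: derivative_eq_intros)
      show "\<xi> t = x + integral {0..t} (\<lambda>s. Fdyn P (\<xi> s) c)" if "t \<in> {0..h}" for t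
        using integral_unique[OF bspec[OF int that]] by simp
    qed
    have dV: "((Vfun P \<circ> \<xi>) has_vector_derivative blinfun_apply (V' (\<xi> s)) (Fdyn P (\<xi> s) c)) (at s within {0..h})"
      if s: "s \<in> {0..h}" for s
      by (rule vector_derivative_diff_chain_within[OF dx[OF s] has_derivative_at_withinI[OF V']])
    have iV: "((\<lambda>s. blinfun_apply (V' (\<xi> s)) (Fdyn P (\<xi> s) c)) has_integral Vfun P (\<xi> h) - Vfun P x) {0..h}"
      using fundamental_theorem_of_calculus[OF h(1) dV] traj_initial[OF tr h(1)] by simp
    have il: "((\<lambda>s. lfun P (\<xi> s) c) has_integral run_cost P h (\<lambda>_. c) \<xi>) {0..h}"
      unfolding run_cost_def using run_cost_integrable[OF tr] by (rule integrable_integral)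
    have Gx: "G (x, c) \<le> 0"
    proof -
      have "frechet_derivative (Vfun P) (at x) = blinfun_apply (V' x)"
        using frechet_derivative_at[OF V'] by simp
      then show ?thesis using kV_decrease[OF x] by (simp add: G_def c_def)
    qed
    have Gle: "blinfun_apply (V' (\<xi> s)) (Fdyn P (\<xi> s) c) + lfun P (\<xi> s) c \<le> e" if s: "s \<in> {0..h}" for s
    proof -
      have "dist (\<xi> s, c) (x, c) < d" using near[OF s] hb by (simp add: dist_Pair_Pair dist_norm)
      then have "dist (G (\<xi> s, c)) (G (x, c)) < e"
        using d(2) inK[of x] inK[OF near1[OF s]] by simp
      then have "G (\<xi> s, c) < e" using Gx by (simp add: dist_real_def)
      then show ?thesis by (simp add: G_def)
    qed
    have le: "Vfun P (\<xi> h) - Vfun P x + run_cost P h (\<lambda>_. c) \<xi> \<le> e * h"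
      using has_integral_le[OF has_integral_add[OF iV il] has_integral_const_real[of e 0 h] Gle] h
      by (simp add: mult.commute)
    have "Vfun P (\<xi> h) \<le> \<beta>"
    proof (cases "Vfun P x \<le> \<beta> / 2")
      case True
      then show ?thesis using le run_cost_nonneg[OF tr] hb(5) by linarith
    next
      case False
      have "r\<^sup>2 \<le> (norm x)\<^sup>2"
      proof -
        have "\<beta> / 2 \<le> MV * (norm x)\<^sup>2" using False Vfun_upper[of x] by linarith
        then show ?thesis unfolding r(2) using MV_pos by (simp add: field_simps)
      qed
      then have rx: "r \<le> norm x" using power2_le_imp_le[of r "norm x"] by simp
      have "e \<le> lfun P (\<xi> s) c" if s: "s \<in> {0..h}" for s
      proof -
        have "r / 2 \<le> norm (\<xi> s)"
          using near[OF s] hb(4) rx norm_triangle_ineq2[of x "\<xi> s"] by (simp add: norm_minus_commute)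
        then have "ml * (r / 2)\<^sup>2 \<le> ml * (norm (\<xi> s))\<^sup>2"
          using r ml_pos by (intro mult_left_mono power_mono) auto
        then show ?thesis using e(3) lfun_lower_state[of "\<xi> s" c] by linarith
      qed
      then have "e * h \<le> run_cost P h (\<lambda>_. c) \<xi>"
        using has_integral_le[OF has_integral_const_real[of e 0 h] il] h by (simp add: mult.commute)
      then show ?thesis using le x by linarith
    qed
    moreover have "e * h \<le> \<epsilon> * h" using e h by (intro mult_right_mono) auto
    ultimately show ?thesis using tr le by (intro exI[of _ "\<lambda>_. c"] exI[of _ \<xi>]) auto
  qed
  then show thesis using that[OF \<delta>] by blast
qed

text \<open>Any time can be divided into equal steps that are short enough. The losses add up to \<open>e t\<close>, and the
choice of \<open>e\<close> keeps this below \<open>\<epsilon>\<close>.\<close>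

lemma approximate_terminal_descent:
  assumes x: "Vfun P x \<le> \<beta>" and t: "0 \<le> t" and "0 < \<epsilon>"
  obtains u \<xi> where "traj P t x u \<xi>" "Vfun P (\<xi> t) \<le> \<beta>"
    "Vfun P (\<xi> t) + run_cost P t u \<xi> \<le> Vfun P x + \<epsilon>"
proof -
  define e where "e = \<epsilon> / (t + 1)"
  have e: "0 < e" using assms by (simp add: e_def)
  obtain \<delta> where \<delta>: "0 < \<delta>" and step: "\<And>x h. \<lbrakk>Vfun P x \<le> \<beta>; 0 \<le> h; h \<le> \<delta>\<rbrakk> \<Longrightarrow>
      \<exists>u \<xi>. traj P h x u \<xi> \<and> Vfun P (\<xi> h) \<le> \<beta> \<and> Vfun P (\<xi> h) + run_cost P h u \<xi> \<le> Vfun P x + e * h"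
    using sample_and_hold_step[OF e] by metis
  obtain n :: nat where n: "t / \<delta> < real n" using reals_Archimedean2 by blast
  have n0: "0 < real n" using n \<delta> t by (meson divide_nonneg_pos le_less_trans)
  define h where "h = t / real n"
  have h: "0 \<le> h" "h \<le> \<delta>" using n n0 \<delta> t by (auto simp: h_def field_simps)
  have "\<exists>u \<xi>. traj P (real k * h) x u \<xi> \<and> Vfun P (\<xi> (real k * h)) \<le> \<beta> \<and>
      Vfun P (\<xi> (real k * h)) + run_cost P (real k * h) u \<xi> \<le> Vfun P x + e * (real k * h)" for k
  proof (induction k)
    case 0
    obtain u \<xi> where "traj P 0 x u \<xi> \<and> Vfun P (\<xi> 0) \<le> \<beta> \<and> Vfun P (\<xi> 0) + run_cost P 0 u \<xi> \<le> Vfun P x + e * 0"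
      using step[OF x, of 0] \<delta> by auto
    then show ?case by auto
  next
    case (Suc k)
    then obtain u \<xi> where u: "traj P (real k * h) x u \<xi>" "Vfun P (\<xi> (real k * h)) \<le> \<beta>"
      "Vfun P (\<xi> (real k * h)) + run_cost P (real k * h) u \<xi> \<le> Vfun P x + e * (real k * h)" by blast
    obtain v \<eta> where v: "traj P h (\<xi> (real k * h)) v \<eta>" "Vfun P (\<eta> h) \<le> \<beta>"
      "Vfun P (\<eta> h) + run_cost P h v \<eta> \<le> Vfun P (\<xi> (real k * h)) + e * h"
      using step[OF u(2) h] by blast
    have kh: "0 \<le> real k * h" and Sk: "real (Suc k) * h = real k * h + h" using h by (auto simp: algebra_simps)
    have "concat_at (real k * h) \<xi> \<eta> (real k * h + h) = \<eta> h"
      by (rule concat_at_end[where \<xi> = \<xi> and \<eta> = \<eta>, OF traj_initial[OF v(1) h(1)] h(1)])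
    then show ?case
      using traj_concat_at[OF u(1) v(1) kh h(1)] run_cost_concat_at[OF u(1) v(1) kh h(1)] u(3) v(2,3)
      unfolding Sk
      by (intro exI[of _ "concat_at (real k * h) u v"] exI[of _ "concat_at (real k * h) \<xi> \<eta>"]) (simp add: algebra_simps)
  qed
  from this[of n] obtain u \<xi> where u: "traj P t x u \<xi>" "Vfun P (\<xi> t) \<le> \<beta>"
      "Vfun P (\<xi> t) + run_cost P t u \<xi> \<le> Vfun P x + e * t"
    using n0 by (auto simp: h_def)
  have "e * t \<le> \<epsilon>" using t assms(3) by (simp add: e_def field_simps)
  then show thesis using u that by force
qed

lemma admissible_iff_traj: "admissible P x u \<xi> \<longleftrightarrow> traj P (horizon P) x u \<xi>"
  by (simp add: admissible_def traj_def plant_sol_def)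

lemma cost_run_cost: "cost P u \<xi> = Vfun P (\<xi> (horizon P)) + run_cost P (horizon P) u \<xi>"
  by (simp add: cost_def run_cost_def)

lemma cost_nonneg: "admissible P x u \<xi> \<Longrightarrow> 0 \<le> cost P u \<xi>"
  unfolding cost_run_cost admissible_iff_traj using Vfun_nonneg run_cost_nonneg by (meson add_nonneg_nonneg)

lemma opt_cost_le:
  assumes "traj P (horizon P) x u \<xi>"
  shows "opt_cost P x \<le> Vfun P (\<xi> (horizon P)) + run_cost P (horizon P) u \<xi>"
  unfolding opt_cost_def cost_run_cost[symmetric]
proof (rule cInf_lower)
  show "cost P u \<xi> \<in> {cost P u \<xi> | u \<xi>. admissible P x u \<xi>}" using assms admissible_iff_traj by blast
  show "bdd_below {cost P u \<xi> | u \<xi>. admissible P x u \<xi>}"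
    using cost_nonneg by (intro bdd_belowI[of _ 0]) auto
qed

lemma opt_cost_eq:
  assumes "optimal_solution P x u \<xi>"
  shows "opt_cost P x = Vfun P (\<xi> (horizon P)) + run_cost P (horizon P) u \<xi>"
  unfolding opt_cost_def cost_run_cost[symmetric]
  by (rule cInf_eq_minimum) (use assms in \<open>auto simp: optimal_solution_def\<close>)

lemma opt_cost_nonneg:
  assumes "optimal_solution P x u \<xi>" shows "0 \<le> opt_cost P x"
  using opt_cost_eq[OF assms] cost_nonneg[of x u \<xi>] assms by (simp add: optimal_solution_def cost_run_cost)

text \<open>The losses of the sampled terminal control are arbitrarily small and therefore disappear in the infimum.\<close>

lemma opt_cost_le_Vfun:
  assumes "Vfun P x \<le> \<beta>" shows "opt_cost P x \<le> Vfun P x"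
proof (rule field_le_epsilon)
  fix \<epsilon> :: real assume "0 < \<epsilon>"
  then obtain u \<xi> where "traj P (horizon P) x u \<xi>"
    "Vfun P (\<xi> (horizon P)) + run_cost P (horizon P) u \<xi> \<le> Vfun P x + \<epsilon>"
    using approximate_terminal_descent[OF assms less_imp_le[OF horizon_pos], of \<epsilon>] by metis
  then show "opt_cost P x \<le> Vfun P x + \<epsilon>" using opt_cost_le by fastforce
qed

text \<open>If the optimal trajectory meets \<open>\<Omega>\<^sub>\<beta>\<close> at all, the remaining optimal cost is at most \<open>\<beta>\<close>, as the terminal
controller could take over. If it never did, the running cost would amount to at least
\<open>\<beta> m\<^sub>l T / M\<^sub>V\<close>, which together with a terminal cost above \<open>\<beta>\<close> exceeds the level \<open>\<alpha>\<close>.\<close>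

lemma terminal_state_in_Omega:
  assumes opt: "optimal_solution P x u \<xi>"
    and le: "opt_cost P x \<le> \<beta> * (1 + ml / MV * horizon P)"
  shows "Vfun P (\<xi> (horizon P)) \<le> \<beta>"
proof (cases "\<exists>s\<in>{0..horizon P}. Vfun P (\<xi> s) \<le> \<beta>")
  case True
  then obtain s where s: "0 \<le> s" "s \<le> horizon P" and Vs: "Vfun P (\<xi> s) \<le> \<beta>" by auto
  have tr: "traj P (horizon P) x u \<xi>"
    using opt by (simp add: optimal_solution_def admissible_iff_traj)
  have rs: "0 \<le> horizon P - s" using s by simp
  show ?thesis
  proof (rule field_le_epsilon)
    fix \<epsilon> :: real assume "0 < \<epsilon>"
    then obtain v \<eta> where v: "traj P (horizon P - s) (\<xi> s) v \<eta>"
      "Vfun P (\<eta> (horizon P - s)) + run_cost P (horizon P - s) v \<eta> \<le> Vfun P (\<xi> s) + \<epsilon>"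
      using approximate_terminal_descent[OF Vs rs] by metis
    note hd = traj_head[OF tr s(2)]
    have "opt_cost P x \<le> Vfun P (\<eta> (horizon P - s)) + (run_cost P s u \<xi> + run_cost P (horizon P - s) v \<eta>)"
      using opt_cost_le[of x "concat_at s u v" "concat_at s \<xi> \<eta>"] traj_concat_at[OF hd v(1) s(1) rs]
        run_cost_concat_at[OF hd v(1) s(1) rs] concat_at_end[where s = s and t = "horizon P - s" and \<xi> = \<xi> and \<eta> = \<eta>, OF traj_initial[OF v(1) rs] rs] by simp
    moreover have "opt_cost P x \<ge> Vfun P (\<xi> (horizon P)) + run_cost P s u \<xi>"
      using opt_cost_eq[OF opt] run_cost_tail[OF tr s] run_cost_nonneg[OF traj_tail[OF tr s]] by linarith
    ultimately show "Vfun P (\<xi> (horizon P)) \<le> \<beta> + \<epsilon>" using v(2) Vs by linarith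
  qed
next
  case False
  have tr: "traj P (horizon P) x u \<xi>"
    using opt by (simp add: optimal_solution_def admissible_iff_traj)
  have r2: "(sqrt (\<beta> / MV))\<^sup>2 = \<beta> / MV" using beta_pos MV_pos by simp
  have "sqrt (\<beta> / MV) \<le> norm (\<xi> s)" if s: "s \<in> {0..horizon P}" for s
  proof (rule power2_le_imp_le)
    have "\<beta> \<le> MV * (norm (\<xi> s))\<^sup>2" using False s Vfun_upper[of "\<xi> s"] by force
    then show "(sqrt (\<beta> / MV))\<^sup>2 \<le> (norm (\<xi> s))\<^sup>2" unfolding r2 using MV_pos by (simp add: field_simps)
  qed simp
  then have "horizon P * ml * (\<beta> / MV) \<le> run_cost P (horizon P) u \<xi>"
    using run_cost_lower[OF tr, of "horizon P" "sqrt (\<beta> / MV)", unfolded r2] horizon_pos beta_pos MV_pos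
    by simp
  moreover have "\<beta> * (1 + ml / MV * horizon P) = \<beta> + horizon P * ml * (\<beta> / MV)"
    by (simp add: algebra_simps)
  ultimately show ?thesis using opt_cost_eq[OF opt] le by linarith
qed

text \<open>The tail of the optimal trajectory, prolonged by the terminal controller for the time \<open>h\<close>, is a candidate
for the problem that starts at \<open>\<xi> h\<close>; the prolongation costs no more than the terminal cost it replaces.\<close>

lemma opt_cost_decrease:
  assumes opt: "optimal_solution P x u \<xi>" and V: "Vfun P (\<xi> (horizon P)) \<le> \<beta>"
    and h: "0 \<le> h" "h \<le> horizon P"
  shows "opt_cost P (\<xi> h) + run_cost P h u \<xi> \<le> opt_cost P x"
proof (rule field_le_epsilon)
  fix \<epsilon> :: real assume "0 < \<epsilon>"
  then obtain v \<eta> where v: "traj P h (\<xi> (horizon P)) v \<eta>"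
    "Vfun P (\<eta> h) + run_cost P h v \<eta> \<le> Vfun P (\<xi> (horizon P)) + \<epsilon>"
    using approximate_terminal_descent[OF V h(1)] by metis
  have tr: "traj P (horizon P) x u \<xi>"
    using opt by (simp add: optimal_solution_def admissible_iff_traj)
  let ?s = "horizon P - h"
  have s: "0 \<le> ?s" using h by simp
  let ?u = "\<lambda>\<tau>. u (h + \<tau>)" and ?\<xi> = "\<lambda>\<tau>. \<xi> (h + \<tau>)"
  note tl = traj_tail[OF tr h]
  have v': "traj P h (?\<xi> ?s) v \<eta>" using v(1) by simp
  have "opt_cost P (\<xi> h) \<le> Vfun P (\<eta> h) + (run_cost P ?s ?u ?\<xi> + run_cost P h v \<eta>)"
    using opt_cost_le[of "\<xi> h" "concat_at ?s ?u v" "concat_at ?s ?\<xi> \<eta>"] traj_concat_at[OF tl v' s h(1)]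
      run_cost_concat_at[OF tl v' s h(1)] concat_at_end[where s = ?s and t = h and \<xi> = ?\<xi> and \<eta> = \<eta>, OF traj_initial[OF v' h(1)] h(1)] by simp
  then show "opt_cost P (\<xi> h) + run_cost P h u \<xi> \<le> opt_cost P x + \<epsilon>"
    using v(2) opt_cost_eq[OF opt] run_cost_tail[OF tr h] by linarith
qed

text \<open>Inside \<open>\<Omega>\<^sub>\<beta>\<close> the bound is \<open>J \<le> V\<close>; outside, \<open>\<parallel>x\<parallel>\<^sup>2\<close> is bounded below by \<open>\<beta> / M\<^sub>V\<close> while \<open>J\<close> is bounded above.\<close>

lemma opt_cost_quadratic:
  assumes "opt_cost P x \<le> \<beta> * (1 + ml / MV * horizon P)"
  shows "opt_cost P x \<le> (1 + ml / MV * horizon P) * MV * (norm x)\<^sup>2"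
proof -
  let ?a = "1 + ml / MV * horizon P"
  have a: "1 \<le> ?a" using ml_pos MV_pos horizon_pos by simp
  show ?thesis
  proof (cases "Vfun P x \<le> \<beta>")
    case True
    have "opt_cost P x \<le> 1 * (MV * (norm x)\<^sup>2)" using opt_cost_le_Vfun[OF True] Vfun_upper[of x] by linarith
    also have "\<dots> \<le> ?a * (MV * (norm x)\<^sup>2)" using a MV_pos by (intro mult_right_mono) auto
    finally show ?thesis by (simp add: mult.assoc)
  next
    case False
    then have "\<beta> \<le> MV * (norm x)\<^sup>2" using Vfun_upper[of x] by linarith
    then have "\<beta> * ?a \<le> MV * (norm x)\<^sup>2 * ?a" using a by (intro mult_right_mono) auto
    then show ?thesis using assms by (simp add: mult_ac)
  qed
qed

end

section \<open>Effect of the ADMM error on the plant\<close>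

lemma norm_xblk_le: "norm (xblk P S x) \<le> norm x"
  by (rule norm_le_componentwise_cart) (simp add: xblk_def)

lemma norm_copies_le:
  fixes P :: "('a::finite, 'n::finite, 'm::finite) dmpc_problem"
  shows "norm (copies P x) \<le> real CARD('a) * norm x"
proof -
  have "norm (copies P x) \<le> (\<Sum>i\<in>UNIV. norm (copies P x $ i))"
    unfolding norm_vec_def by (rule L2_set_le_sum) simp
  also have "\<dots> \<le> (\<Sum>i\<in>(UNIV :: 'a set). norm x)"
    by (intro sum_mono) (simp add: copies_def norm_xblk_le)
  finally show ?thesis by simp
qed

lemma copies_diff: "copies P x - copies P y = copies P (x - y)"
  by (simp add: copies_def xblk_def vec_eq_iff)

text \<open>The multiplier step \<open>\<mu> = \<mu>\<^sup>0 + \<rho> (z - x, \<dots>)\<close> expresses \<open>x\<close> through the iterates, all of which are within \<open>e\<close> of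
their optimal values. At the optimum \<open>z'\<close> is also the optimal state, so this bounds the error of
the decoupled state directly.\<close>

lemma decoupled_state_error:
  fixes x z z' :: "real ^ 'n::finite" and \<mu> \<mu>0 \<mu>' :: "(real ^ 'n) \<times> (real ^ 'n ^ 'a::finite)"
  assumes "0 < \<rho>" and upd: "\<mu> = \<mu>0 + \<rho> *\<^sub>R (z - x, r)"
    and "norm (z - z') \<le> e" "norm (\<mu> - \<mu>') \<le> e" "norm (\<mu>0 - \<mu>') \<le> e"
  shows "norm (x - z') \<le> (1 + 2 / \<rho>) * e"
proof -
  have "\<rho> *\<^sub>R (z - x) = fst (\<mu> - \<mu>')  - fst (\<mu>0 - \<mu>')" using upd by simp
  then have "\<rho> * norm (z - x) = norm (fst (\<mu> - \<mu>')  - fst (\<mu>0 - \<mu>'))"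
    using assms(1) by (metis abs_of_pos norm_scaleR)
  also have "\<dots> \<le> norm (fst (\<mu> - \<mu>')) + norm (fst (\<mu>0 - \<mu>'))" by (rule norm_triangle_ineq4)
  also have "\<dots> \<le> norm (\<mu> - \<mu>') + norm (\<mu>0 - \<mu>')"
    by (intro add_mono) (metis norm_fst_le prod.collapse)+
  also have "\<dots> \<le> 2 * e" using assms by simp
  finally have "norm (z - x) \<le> 2 * e / \<rho>" using assms(1) by (simp add: field_simps)
  moreover have "norm (x - z') \<le> norm (z - z') + norm (z - x)"
    using norm_triangle_ineq4[of "z - z'" "z - x"] by simp
  ultimately show ?thesis using assms(3) by (simp add: algebra_simps)
qed

text \<open>Gronwall's inequality for the difference of the trajectories. The Lipschitz bound of the decoupled dynamics
has a third term for the copies, which accounts for the factor \<open>1 + N\<close> in the exponent.\<close>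

lemma plant_prediction_error:
  fixes P :: "('a::finite, 'n::finite, 'm::finite) dmpc_problem"
  assumes pos: "0 < horizon P" "0 \<le> Lf" "0 \<le> w"
    and f: "plant_sol P xk u \<xi>" and g: "plant_sol P xk u' \<xi>'"
    and lip: "\<And>\<tau>. \<tau> \<in> {0..horizon P} \<Longrightarrow> norm (Fdyn P (\<xi> \<tau>) (u \<tau>) - Fdyn P (\<xi>' \<tau>) (u' \<tau>))
       \<le> Lf * (norm (\<xi> \<tau> - \<xi>' \<tau>) + norm (u \<tau> - u' \<tau>) + norm (copies P (\<xi> \<tau>) - copies P (\<xi>' \<tau>)))"
    and w: "\<And>\<tau>. \<tau> \<in> {0..horizon P} \<Longrightarrow> norm (u \<tau> - u' \<tau>) \<le> w"
    and t: "t \<in> {0..horizon P}"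
  shows "norm (\<xi> t - \<xi>' t) \<le> Lf * w * horizon P * exp (Lf * (1 + real CARD('a)) * horizon P)"
proof -
  let ?N = "real CARD('a)" and ?T = "horizon P"
  let ?w = "\<lambda>s. Fdyn P (\<xi> s) (u s) - Fdyn P (\<xi>' s) (u' s)"
  have "norm (\<xi> t - \<xi>' t) \<le> (norm (0 :: real ^ 'n) + (Lf * w) * ?T) * exp (Lf * (1 + ?N) * t)"
  proof (rule gronwall_has_integral[where w = ?w, OF _ _ _ _ _ t])
    show "continuous_on {0..?T} (\<lambda>t. \<xi> t - \<xi>' t)"
      using f g unfolding plant_sol_def ode_sol_def by (auto intro: continuous_on_diff)
    fix s assume s: "s \<in> {0..?T}"
    have "((\<lambda>s. Fdyn P (\<xi> s) (u s)) has_integral (\<xi> s - xk)) {0..s}"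
      "((\<lambda>s. Fdyn P (\<xi>' s) (u' s)) has_integral (\<xi>' s - xk)) {0..s}"
      using f g s unfolding plant_sol_def ode_sol_def by auto
    from has_integral_diff[OF this] show "(?w has_integral (\<xi> s - \<xi>' s - 0)) {0..s}" by simp
    have "norm (?w s) \<le> Lf * (norm (\<xi> s - \<xi>' s) + norm (u s - u' s) + norm (copies P (\<xi> s) - copies P (\<xi>' s)))"
      by (rule lip[OF s])
    also have "\<dots> \<le> Lf * (norm (\<xi> s - \<xi>' s) + w + ?N * norm (\<xi> s - \<xi>' s))"
      using pos w[OF s] norm_copies_le[of P "\<xi> s - \<xi>' s"] by (intro mult_left_mono add_mono) (auto simp: copies_diff)
    finally show "norm (?w s) \<le> Lf * w + Lf * (1 + ?N) * norm (\<xi> s - \<xi>' s)" by (simp add: algebra_simps)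
  qed (use pos in auto)
  also have "\<dots> \<le> (norm (0 :: real ^ 'n) + (Lf * w) * ?T) * exp (Lf * (1 + ?N) * ?T)"
    using pos t by (intro mult_left_mono) (auto intro!: mult_left_mono)
  finally show ?thesis by simp
qed

section \<open>The size of the initial level set\<close>

text \<open>The quotient \<open>m\<^sub>J / M\<^sub>J\<close> is at most one because \<open>1 - 1 / q \<le> q - 1\<close>, and the denominator contains the square
of a number above one.\<close>

lemma alpha_hat_less:
  fixes P :: "('a::finite, 'n::finite, 'm::finite) dmpc_problem"
  assumes pos: "0 < horizon P" "0 < penalty P" "0 < sampling P" "0 < ml" "ml \<le> Ml" "0 \<le> MV"
    "0 < Lf" "0 < Lks" "0 < Lk" "C < 1" "0 < d" "0 < \<alpha>"
  shows "alpha_hat P ml Ml MV Lf Lks Lk C \<alpha> d < \<alpha>"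
proof -
  define Lh where "Lh = L_hat Lf Lks"
  define T where "T = horizon P"
  define mJ where "mJ = m_J ml Lh T"
  define MJ where "MJ = M_J Ml MV Lks Lh T"
  define E where "E = exp (Lh * sampling P) + D_const P Lf Lk C * d"
  have Lh: "0 < Lh" using pos by (simp add: Lh_def L_hat_def)
  have T: "0 < T" using pos by (simp add: T_def)
  define q where "q = exp (2 * Lh * T)"
  have q: "1 < q" using Lh T by (simp add: q_def)
  have qi: "exp (- 2 * Lh * T) = 1 / q" by (simp add: q_def exp_minus inverse_eq_divide)
  have "1 - 1 / q \<le> q - 1"
  proof -
    have "q - 1 - (1 - 1 / q) = (q - 1)\<^sup>2 / q" using q by (simp add: field_simps power2_eq_square)
    moreover have "0 \<le> (q - 1)\<^sup>2 / q" using q by simp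
    ultimately show ?thesis by linarith
  qed
  then have "mJ \<le> Ml / (2 * Lh) * (q - 1)"
    unfolding mJ_def m_J_def qi using pos Lh q by (intro mult_mono divide_right_mono) auto
  also have "\<dots> \<le> Ml / (2 * Lh) * (1 + Lks\<^sup>2) * (q - 1)"
  proof (intro mult_right_mono)
    show "Ml / (2 * Lh) \<le> Ml / (2 * Lh) * (1 + Lks\<^sup>2)"
      using mult_left_mono[of 1 "1 + Lks\<^sup>2" "Ml / (2 * Lh)"] pos Lh by simp
  qed (use q in simp)
  also have "\<dots> \<le> MJ" unfolding MJ_def M_J_def q_def[symmetric] using pos q by simp
  finally have le: "mJ \<le> MJ" .
  have mJ: "0 < mJ" unfolding mJ_def m_J_def qi using pos Lh q by simp
  have "0 \<le> D_const P Lf Lk C"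
    using pos by (simp add: D_const_def Let_def)
  then have "0 \<le> D_const P Lf Lk C * d" using pos by simp
  moreover have "1 < exp (Lh * sampling P)" using Lh pos by simp
  ultimately have "1 < E" unfolding E_def by linarith
  then have E: "1 < E\<^sup>2" by (simp add: one_less_power)
  have "mJ * 1 < MJ * E\<^sup>2" using le mJ E by (intro mult_le_less_imp_less) auto
  then have "mJ * \<alpha> / (MJ * E\<^sup>2) < \<alpha>" using pos mJ le E by (simp add: field_simps)
  then show ?thesis
    by (simp add: alpha_hat_def Let_def mJ_def MJ_def E_def Lh_def T_def)
qed

section \<open>Exponential stability of the closed loop\<close>

theorem theorem3:
  fixes P :: "('a::finite, 'n::finite, 'm::finite) dmpc_problem"
    and ml Ml mV MV \<beta> \<alpha> \<alpha>h d Lf Lks Lk C C0 \<sigma>z \<sigma>\<mu> :: real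
    and us :: "real ^ 'n \<Rightarrow> real \<Rightarrow> real ^ 'm"
    and vs :: "real ^ 'n \<Rightarrow> real \<Rightarrow> real ^ 'n ^ 'a"
    and xs zs :: "real ^ 'n \<Rightarrow> real \<Rightarrow> real ^ 'n"
    and \<mu>s :: "real ^ 'n \<Rightarrow> real \<Rightarrow> ('a, 'n) mult"
    and \<kappa>s :: "real ^ 'n \<Rightarrow> real ^ 'n \<Rightarrow> real ^ 'm"
    and \<kappa> :: "real ^ 'n \<Rightarrow> (real \<Rightarrow> real ^ 'n) \<Rightarrow> (real \<Rightarrow> ('a, 'n) mult) \<Rightarrow> real ^ 'n \<Rightarrow> real ^ 'm"
    and zinit :: "real ^ 'n \<Rightarrow> real \<Rightarrow> real ^ 'n"
    and \<mu>init :: "real ^ 'n \<Rightarrow> real \<Rightarrow> ('a, 'n) mult"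
    and R :: "nat \<Rightarrow> real ^ 'n \<Rightarrow> ('a, 'n, 'm) dmpc_run"
    and Tr :: "((real ^ 'n) \<times> (real ^ 'm) \<times> (real ^ 'n ^ 'a)) set"
    and T :: real and \<Gamma> \<Gamma>h X :: "(real ^ 'n) set"
    and M\<alpha> M\<sigma> :: "(real \<Rightarrow> ('a, 'n) mult) set" and Z\<alpha> Z\<sigma> :: "(real \<Rightarrow> real ^ 'n) set"
    and steps :: "(nat \<times> (real ^ 'n) \<times> nat) set"
  defines "T \<equiv> horizon P"
    and "\<alpha> \<equiv> \<beta> * (1 + ml / MV * horizon P)"
    and "\<Gamma> \<equiv> level_set P \<alpha>"
    and "\<alpha>h \<equiv> alpha_hat P ml Ml MV Lf Lks Lk C \<alpha> d"
    and "\<Gamma>h \<equiv> level_set P \<alpha>h"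
    and "M\<alpha> \<equiv> \<mu>s ` \<Gamma>"
    and "Z\<alpha> \<equiv> zs ` \<Gamma>"
    and "M\<sigma> \<equiv> sigma_nbhd T (mult_space P) \<sigma>\<mu> M\<alpha>"
    and "Z\<sigma> \<equiv> sigma_nbhd T UNIV \<sigma>z Z\<alpha>"
    and "X \<equiv> fst ` Tr"
    and "steps \<equiv> steps_within P R \<Gamma>h \<Gamma>"
  assumes standing: "standing_assumptions P ml Ml mV MV"
    and optimal: "\<forall>xk. optimal_solution P xk (us xk) (xs xk)"
    and primal: "\<forall>xk\<in>\<Gamma>. optimal_primal P xk (us xk) (vs xk) (xs xk) (zs xk)"
    and scheme: "\<forall>q\<ge>1. \<forall>x0\<in>\<Gamma>h. is_dmpc_run P (\<lambda>_. q) (zinit x0) (\<mu>init x0) x0 (R q x0)"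
    and kappa_star: "\<forall>xk\<in>\<Gamma>. \<forall>\<tau>\<in>{0..T}. us xk \<tau> = \<kappa>s (xs xk \<tau>) xk"
    and kappa: "\<forall>(q, x0, k)\<in>steps. \<forall>\<tau>\<in>{0..T}. uit (R q x0) k q \<tau> =
        \<kappa> (xit (R q x0) k q \<tau>) (zit (R q x0) k (q - 1)) (muit (R q x0) k (q - 1))
          (mpc_state P (R q x0) k)"
    and kappa_eq: "\<forall>xk\<in>\<Gamma>. \<forall>x\<in>X. \<kappa>s x xk = \<kappa> x (zs xk) (\<mu>s xk) xk"
    and Tr_compact: "compact Tr"
    and Tr_opt: "\<forall>xk\<in>\<Gamma>. \<forall>\<tau>\<in>{0..T}. (xs xk \<tau>, us xk \<tau>, vs xk \<tau>) \<in> Tr"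
    and Tr_admm: "\<forall>(q, x0, k)\<in>steps. \<forall>\<tau>\<in>{0..T}.
        (xit (R q x0) k q \<tau>, uit (R q x0) k q \<tau>, vit (R q x0) k q \<tau>) \<in> Tr"
    and Tr_plant: "\<forall>(q, x0, k)\<in>steps. \<forall>\<tau>\<in>{0..T}.
        (xF (R q x0) k \<tau>, uit (R q x0) k q \<tau>, copies P (xF (R q x0) k \<tau>)) \<in> Tr"
    and L_pos: "0 < Lf" "0 < Lks" "0 < Lk"
    and Lf: "\<forall>(x, u, v)\<in>Tr. \<forall>(x', u', v')\<in>Tr.
        norm (dyn P x u v - dyn P x' u' v') \<le> Lf * (norm (x - x') + norm (u - u') + norm (v - v'))"
    and Lf_lin: "\<forall>(x, u, v)\<in>Tr. v = copies P x \<longrightarrow> norm (Fdyn P x u) \<le> Lf * (norm x + norm u)"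
    and Lks: "\<forall>xk\<in>\<Gamma>. \<forall>x\<in>X. \<forall>x'\<in>X. norm (\<kappa>s x xk - \<kappa>s x' xk) \<le> Lks * norm (x - x')"
    and Lks_lin: "\<forall>xk\<in>\<Gamma>. \<forall>x\<in>X. norm (\<kappa>s x xk) \<le> Lks * norm x"
    and Lk: "\<forall>xk\<in>\<Gamma>. \<forall>x\<in>X. \<forall>x'\<in>X. \<forall>z\<in>Z\<sigma>. \<forall>z'\<in>Z\<sigma>. \<forall>\<mu>\<in>M\<sigma>. \<forall>\<mu>'\<in>M\<sigma>.
        norm (\<kappa> x z \<mu> xk - \<kappa> x' z' \<mu>' xk)
          \<le> Lk * (norm (x - x') + linf_dist T z z' + linf_dist T \<mu> \<mu>')"
    and compact_MZ: "sup_compact T M\<alpha>" "M\<alpha> \<noteq> {}" "sup_compact T Z\<alpha>" "Z\<alpha> \<noteq> {}"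
    and d_pos: "0 < d"
    and beta_pos: "0 < \<beta>"
    and Omega: "compact {x. Vfun P x \<le> \<beta>}" "{x. Vfun P x \<le> \<beta>} \<noteq> {}"
    and h1: "\<exists>\<kappa>V. \<forall>x. Vfun P x \<le> \<beta> \<longrightarrow> \<kappa>V x \<in> Uall P \<and>
        frechet_derivative (Vfun P) (at x) (Fdyn P x (\<kappa>V x)) + lfun P x (\<kappa>V x) \<le> 0"
    and h2_J: "C2 (opt_cost P)"
    and h2_kappa_star: "loc_lipschitz dist dist (X \<times> \<Gamma>) (\<lambda>(x, xk). \<kappa>s x xk)"
    and h2_kappa: "loc_lipschitz (kappa_dist T) dist (X \<times> Z\<sigma> \<times> M\<sigma> \<times> \<Gamma>)
        (\<lambda>(x, z, \<mu>, xk). \<kappa> x z \<mu> xk)"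
    and h3_saddle: "\<forall>xk\<in>\<Gamma>. \<mu>s xk \<in> Linf T (mult_space P) \<and>
        saddle_point P xk (us xk) (vs xk) (xs xk) (zs xk) (\<mu>s xk)"
    and h3_unique: "\<forall>xk\<in>\<Gamma>. \<forall>\<mu>\<in>Linf T (mult_space P).
        saddle_point P xk (us xk) (vs xk) (xs xk) (zs xk) \<mu> \<longrightarrow>
        (AE \<tau> in lebesgue_on {0..T}. \<mu> \<tau> = \<mu>s xk \<tau>)"
    and h3_lipschitz: "loc_lipschitz dist (linf_dist T) \<Gamma> \<mu>s" "loc_lipschitz dist (linf_dist T) \<Gamma> zs"
    and sigma_pos: "0 < \<sigma>\<mu>" "0 < \<sigma>z"
    and h4: "\<forall>(qh, x0, k)\<in>steps. \<forall>q\<le>qh.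
        muit (R qh x0) k q \<in> M\<sigma> \<and> zit (R qh x0) k q \<in> Z\<sigma>"
    and C: "0 < C0" "0 \<le> C" "C < 1"
    and h5: "\<forall>(qh, x0, k)\<in>steps. \<forall>q\<le>qh. let xk = mpc_state P (R qh x0) k in
        stack_dist T (zit (R qh x0) k q) (muit (R qh x0) k q) (zs xk) (\<mu>s xk)
          \<le> C0 * C ^ q * stack_dist T (zit (R qh x0) k 0) (muit (R qh x0) k 0) (zs xk) (\<mu>s xk)"
  shows "\<exists>qh>0.
      uniform_exp_decay \<Gamma>h (\<lambda>x0 k. opt_cost P (mpc_state P (R qh x0) k)) \<and>
      uniform_exp_decay \<Gamma>h (\<lambda>x0 k. linf T (\<lambda>\<tau>. xF (R qh x0) k \<tau> - xs (mpc_state P (R qh x0) k) \<tau>)) \<and>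
      (\<exists>\<gamma>1>0. \<exists>\<gamma>2>0. \<forall>x0\<in>\<Gamma>h. \<forall>t\<ge>0. norm (plant (R qh x0) t) \<le> \<gamma>1 * exp (- \<gamma>2 * t))"
proof -
  let ?J = "opt_cost P" and ?dt = "sampling P" and ?\<rho> = "penalty P" and ?N = "real CARD('a)"
  obtain \<kappa>V where "\<forall>x. Vfun P x \<le> \<beta> \<longrightarrow> \<kappa>V x \<in> Uall P \<and>
      frechet_derivative (Vfun P) (at x) (Fdyn P x (\<kappa>V x)) + lfun P x (\<kappa>V x) \<le> 0"
    using h1 by blast
  then interpret ctl: terminal_controller P ml Ml mV MV \<beta> \<kappa>V
    using standing beta_pos Omega by unfold_locales auto
  have T: "0 < T" and dt: "0 < ?dt" "?dt \<le> T" and rho: "0 < ?\<rho>"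
    using standing by (simp_all add: standing_assumptions_def T_def)
  have ml: "0 < ml" by (rule ctl.ml_pos)
  have MV: "0 < MV" by (rule ctl.MV_pos)
  have alpha: "0 < \<alpha>"
    unfolding \<alpha>_def using beta_pos ml MV T by (simp add: T_def add_pos_nonneg)
  have J_nonneg: "0 \<le> ?J x" for x using ctl.opt_cost_nonneg optimal by blast
  have opt: "optimal_solution P x (us x) (xs x)" for x using optimal by blast
  have tr: "traj P T x (us x) (xs x)" for x
    using opt[of x] by (simp add: optimal_solution_def ctl.admissible_iff_traj T_def)
  have xs0: "xs x 0 = x" for x using traj_initial[OF tr] T by simp
  have Gamma_iff: "x \<in> \<Gamma> \<longleftrightarrow> ?J x \<le> \<alpha>" for x by (simp add: \<Gamma>_def level_set_def)

  \<comment> \<open>The level set is compact: it lies in the compact region of the trajectories, and the optimal cost is continuous.\<close>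
  have "bounded X"
    unfolding X_def using Tr_compact by (intro compact_imp_bounded compact_continuous_image continuous_intros)
  then obtain BX where BX: "\<And>x. x \<in> X \<Longrightarrow> norm x \<le> BX" unfolding bounded_iff by blast
  have xs_X: "xs x \<tau> \<in> X" if "x \<in> \<Gamma>" "\<tau> \<in> {0..T}" for x \<tau>
    using Tr_opt that unfolding X_def by force
  have "\<Gamma> \<subseteq> X" using xs_X[of _ 0] xs0 T by auto
  then have "bounded \<Gamma>" using \<open>bounded X\<close> bounded_subset by blast
  moreover have "closed \<Gamma>"
    unfolding \<Gamma>_def level_set_def by (intro closed_Collect_le C2_continuous h2_J continuous_intros)
  ultimately have Gamma_compact: "compact \<Gamma>" by (simp add: compact_eq_bounded_closed)

  \<comment> \<open>Along optimal trajectories the closed-loop field grows at most linearly, with constant \<open>Lh\<close>.\<close>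
  define Lh where "Lh = L_hat Lf Lks"
  define g where "g = exp (Lh * T)"
  have Lh: "0 < Lh" using L_pos by (simp add: Lh_def L_hat_def)
  have g: "0 < g" by (simp add: g_def)
  have opt_consistent: "zs x \<tau> = xs x \<tau>" "vs x \<tau> = copies P (xs x \<tau>)" if "x \<in> \<Gamma>" "\<tau> \<in> {0..T}" for x \<tau>
  proof -
    have "zs x \<tau> - xs x \<tau> = 0 \<and> copies P (zs x \<tau>) - vs x \<tau> = 0"
      using primal that unfolding optimal_primal_def T_def by blast
    then show "zs x \<tau> = xs x \<tau>" "vs x \<tau> = copies P (xs x \<tau>)" by auto
  qed
  have F_lin: "norm (Fdyn P (xs x s) (us x s)) \<le> Lh * norm (xs x s)" if x: "x \<in> \<Gamma>" and s: "s \<in> {0..T}" for x s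
  proof -
    have "(xs x s, us x s, vs x s) \<in> Tr" using Tr_opt x s by blast
    then have "norm (Fdyn P (xs x s) (us x s)) \<le> Lf * (norm (xs x s) + norm (us x s))"
      using Lf_lin opt_consistent(2)[OF x s] by fastforce
    also have "norm (us x s) \<le> Lks * norm (xs x s)"
      using kappa_star Lks_lin xs_X[OF x s] x s by simp
    finally show ?thesis using L_pos by (simp add: Lh_def L_hat_def algebra_simps)
  qed
  have xs_ode: "continuous_on {0..T} (xs x)"
    "\<And>t. t \<in> {0..T} \<Longrightarrow> ((\<lambda>s. Fdyn P (xs x s) (us x s)) has_integral (xs x t - x)) {0..t}" for x
    using tr[of x] unfolding traj_def ode_sol_def by blast+
  have xs_growth: "norm (xs x t) \<le> g * norm x"
    and xs_away: "t \<le> 1 / (2 * Lh * g) \<Longrightarrow> norm x / 2 \<le> norm (xs x t)"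
    if "x \<in> \<Gamma>" "t \<in> {0..T}" for x t
    using linear_growth_bounds[OF Lh xs_ode F_lin[OF that(1)] that(2)] by (auto simp: g_def)

  \<comment> \<open>On \<open>[0, h]\<close> the optimal state keeps at least half of its initial norm.\<close>
  define h where "h = min ?dt (1 / (2 * Lh * g))"
  define m where "m = h * ml / 4"
  have h: "0 < h" "h \<le> ?dt" using dt Lh g by (auto simp: h_def)
  have m: "0 < m" using h ml by (simp add: m_def)
  have J_step: "?J (xs x ?dt) \<le> ?J x - m * (norm x)\<^sup>2" if x: "x \<in> \<Gamma>" for x
  proof -
    have "h * ml * (norm x / 2)\<^sup>2 \<le> run_cost P ?dt (us x) (xs x)"
      by (rule ctl.run_cost_lower[OF traj_head[OF tr dt(2)]])
        (use h dt xs_away[OF x] in \<open>auto simp: h_def\<close>)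
    moreover have "Vfun P (xs x T) \<le> \<beta>"
      using ctl.terminal_state_in_Omega[OF opt] x by (simp add: Gamma_iff \<alpha>_def T_def)
    ultimately show ?thesis
      using ctl.opt_cost_decrease[OF opt, of x ?dt] dt by (simp add: T_def m_def power_divide)
  qed
  have J_lower: "m * (norm x)\<^sup>2 \<le> ?J x" if "x \<in> \<Gamma>" for x
    using J_step[OF that] J_nonneg[of "xs x ?dt"] by linarith
  define cq where "cq = (1 + ml / MV * horizon P) * MV"
  have cq: "0 < cq" using ml MV T by (simp add: cq_def T_def add_pos_nonneg)
  have J_upper: "?J x \<le> cq * (norm x)\<^sup>2" if "x \<in> \<Gamma>" for x
    using ctl.opt_cost_quadratic[of x] that by (simp add: Gamma_iff \<alpha>_def cq_def)
  \<comment> \<open>The maximum with \<open>1 / 2\<close> keeps \<open>\<theta>\<close> positive, by which \<open>sqrt_perturbation\<close> divides.\<close>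
  define \<theta> where "\<theta> = sqrt (max (1 / 2) (1 - m / cq))"
  have th: "0 < \<theta>" "\<theta> < 1" using m cq by (auto simp: \<theta>_def)
  have J_contract: "?J (xs x ?dt) \<le> \<theta>\<^sup>2 * ?J x" if x: "x \<in> \<Gamma>" for x
  proof -
    have "m / cq * ?J x \<le> m / cq * (cq * (norm x)\<^sup>2)"
      using J_upper[OF x] m cq by (intro mult_left_mono) auto
    then have "?J (xs x ?dt) \<le> (1 - m / cq) * ?J x" using J_step[OF x] cq by (simp add: algebra_simps)
    also have "\<dots> \<le> \<theta>\<^sup>2 * ?J x" using J_nonneg by (intro mult_right_mono) (auto simp: \<theta>_def)
    finally show ?thesis .
  qed
  have norm_le_sqrtJ: "norm x \<le> sqrt (?J x) / sqrt m" if "x \<in> \<Gamma>" for x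
  proof -
    have "(norm x)\<^sup>2 \<le> ?J x / m" using J_lower[OF that] m by (simp add: field_simps)
    then show ?thesis using real_le_rsqrt by (simp add: real_sqrt_divide[symmetric])
  qed
  have "?J 0 = 0"
  proof -
    have "Vfun P 0 = 0" using ctl.Vfun_upper[of 0] ctl.Vfun_nonneg[of 0] by simp
    then show ?thesis using ctl.opt_cost_le_Vfun[of 0] beta_pos J_nonneg[of 0] by simp
  qed
  then obtain LJ where LJ: "0 \<le> LJ"
    "\<And>x y. norm x \<le> BX \<Longrightarrow> norm y \<le> BX \<Longrightarrow> ?J y - ?J x \<le> LJ * (norm x + norm y) * norm (y - x)"
    using C2_quadratic_increment[OF h2_J _ J_nonneg] by metis

  have zs_bounded: "bounded (zs x ` {0..T})" and mus_bounded: "bounded (\<mu>s x ` {0..T})" if "x \<in> \<Gamma>" for x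
    using primal h3_saddle that by (auto simp: optimal_primal_def Linf_def T_def)
  obtain Bz Lz where Bz: "0 \<le> Bz" "\<And>x t. x \<in> \<Gamma> \<Longrightarrow> t \<in> {0..T} \<Longrightarrow> norm (zs x t) \<le> Bz" and Lz: "0 \<le> Lz"
    "\<And>x y t. x \<in> \<Gamma> \<Longrightarrow> y \<in> \<Gamma> \<Longrightarrow> t \<in> {0..T} \<Longrightarrow> norm (zs x t - zs y t) \<le> Lz * dist x y"
    using loc_lipschitz_linf_compact[OF h3_lipschitz(2) Gamma_compact zs_bounded] by metis
  obtain Bm Lm where Bm: "0 \<le> Bm" "\<And>x t. x \<in> \<Gamma> \<Longrightarrow> t \<in> {0..T} \<Longrightarrow> norm (\<mu>s x t) \<le> Bm" and Lm: "0 \<le> Lm"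
    "\<And>x y t. x \<in> \<Gamma> \<Longrightarrow> y \<in> \<Gamma> \<Longrightarrow> t \<in> {0..T} \<Longrightarrow> norm (\<mu>s x t - \<mu>s y t) \<le> Lm * dist x y"
    using loc_lipschitz_linf_compact[OF h3_lipschitz(1) Gamma_compact mus_bounded] by metis

  \<comment> \<open>Here \<open>st\<close> is the closed-loop state and \<open>sd\<close> the distance of the warm start from the optimum at that state.\<close>
  define st where "st q x0 k = mpc_state P (R q x0) k" for q x0 k
  define sd where "sd q x0 k = stack_dist T (zit (R q x0) k 0) (muit (R q x0) k 0) (zs (st q x0 k)) (\<mu>s (st q x0 k))"
    for q x0 k
  have steps_iff: "(q, x0, k) \<in> steps \<longleftrightarrow> 1 \<le> q \<and> x0 \<in> \<Gamma>h \<and> (\<forall>j\<le>k. st q x0 j \<in> \<Gamma>)" for q x0 k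
    by (simp add: steps_def steps_within_def st_def)
  have st_Gamma: "st q x0 k \<in> \<Gamma>" if "(q, x0, k) \<in> steps" for q x0 k using that steps_iff by blast
  have run: "is_dmpc_run P (\<lambda>_. q) (zinit x0) (\<mu>init x0) x0 (R q x0)" if "(q, x0, k) \<in> steps" for q x0 k
    using that steps_iff scheme by blast
  have zs_nbhd: "zs x \<in> Z\<sigma>" and mus_nbhd: "\<mu>s x \<in> M\<sigma>" if x: "x \<in> \<Gamma>" for x
  proof -
    have "zs x \<in> Linf T UNIV" "\<mu>s x \<in> Linf T (mult_space P)"
      using primal h3_saddle x by (auto simp: optimal_primal_def T_def)
    then show "zs x \<in> Z\<sigma>" "\<mu>s x \<in> M\<sigma>"
      unfolding Z\<sigma>_def M\<sigma>_def sigma_nbhd_def Z\<alpha>_def M\<alpha>_def using x sigma_pos by force+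
  qed
  have iter_bounded: "bounded (zit (R q x0) k j ` {0..T})" "bounded (muit (R q x0) k j ` {0..T})"
    and iter_nbhd: "zit (R q x0) k j \<in> Z\<sigma>" "muit (R q x0) k j \<in> M\<sigma>"
    if "(q, x0, k) \<in> steps" "j \<le> q" for q x0 k j
    using bspec[OF h4 that(1)] that(2) by (auto simp: Z\<sigma>_def M\<sigma>_def sigma_nbhd_def Linf_def)

  have le_stack_dist: "norm (z t - zs x t) \<le> stack_dist T z \<mu> (zs x) (\<mu>s x)"
      "norm (\<mu> t - \<mu>s x t) \<le> stack_dist T z \<mu> (zs x) (\<mu>s x)"
    if x: "x \<in> \<Gamma>" and t: "t \<in> {0..T}" and b: "bounded (z ` {0..T})" "bounded (\<mu> ` {0..T})" for x t z \<mu>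
  proof -
    have "norm (z t - zs x t, \<mu> t - \<mu>s x t) \<le> stack_dist T z \<mu> (zs x) (\<mu>s x)"
      unfolding stack_dist_def
      by (rule norm_le_linf[OF bounded_Pair_image t]) (intro bounded_diff_image b zs_bounded[OF x] mus_bounded[OF x])+
    then show "norm (z t - zs x t) \<le> stack_dist T z \<mu> (zs x) (\<mu>s x)"
        "norm (\<mu> t - \<mu>s x t) \<le> stack_dist T z \<mu> (zs x) (\<mu>s x)"
      by (meson norm_fst_le norm_snd_le order_trans)+
  qed
  have sd_nonneg: "0 \<le> sd q x0 k" if "(q, x0, k) \<in> steps" for q x0 k
  proof -
    have "0 \<le> norm (zit (R q x0) k 0 0 - zs (st q x0 k) 0)" by simp
    also have "\<dots> \<le> sd q x0 k" unfolding sd_def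
      using T by (intro le_stack_dist st_Gamma[OF that] iter_bounded[OF that]) auto
    finally show ?thesis .
  qed
  \<comment> \<open>The feedback law uses the iterates \<open>q - 1\<close> and the state those of \<open>q\<close>, so both are bounded by the larger of the two errors.\<close>
  have iter_error: "norm (zit (R q x0) k j t - zs (st q x0 k) t) \<le> C0 * C ^ (q - 1) * sd q x0 k"
    "norm (muit (R q x0) k j t - \<mu>s (st q x0 k) t) \<le> C0 * C ^ (q - 1) * sd q x0 k"
    if s: "(q, x0, k) \<in> steps" and j: "q - 1 \<le> j" "j \<le> q" and t: "t \<in> {0..T}" for q x0 k j t
  proof -
    have "stack_dist T (zit (R q x0) k j) (muit (R q x0) k j) (zs (st q x0 k)) (\<mu>s (st q x0 k))
        \<le> C0 * C ^ j * sd q x0 k"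
      using bspec[OF h5 s] j(2) by (simp add: Let_def sd_def st_def)
    also have "\<dots> \<le> C0 * C ^ (q - 1) * sd q x0 k"
      using C j sd_nonneg[OF s] by (intro mult_right_mono mult_left_mono power_decreasing) auto
    finally have "stack_dist T (zit (R q x0) k j) (muit (R q x0) k j) (zs (st q x0 k)) (\<mu>s (st q x0 k))
        \<le> C0 * C ^ (q - 1) * sd q x0 k" .
    then show "norm (zit (R q x0) k j t - zs (st q x0 k) t) \<le> C0 * C ^ (q - 1) * sd q x0 k"
      "norm (muit (R q x0) k j t - \<mu>s (st q x0 k) t) \<le> C0 * C ^ (q - 1) * sd q x0 k"
      using le_stack_dist[OF st_Gamma[OF s] t iter_bounded[OF s j(2)]] by (meson order_trans)+
  qed

  \<comment> \<open>Prediction error of the plant over the whole horizon, proportional to \<open>C\<^sup>q\<^sup>-\<^sup>1\<close>.\<close>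
  define A where "A = Lf * (Lk * (3 + 2 / ?\<rho>)) * T * exp (Lf * (1 + ?N) * T) * C0"
  have A: "0 \<le> A" using L_pos rho T C by (simp add: A_def)
  have pred_error: "norm (xF (R q x0) k t - xs (st q x0 k) t) \<le> A * C ^ (q - 1) * sd q x0 k"
    if s: "(q, x0, k) \<in> steps" and t: "t \<in> {0..T}" for q x0 k t
  proof -
    define r x e where "r = R q x0" and "x = st q x0 k" and "e = C0 * C ^ (q - 1) * sd q x0 k"
    have q: "1 \<le> q" and x: "x \<in> \<Gamma>" using s steps_iff by (auto simp: x_def)
    have e: "0 \<le> e" using C sd_nonneg[OF s] by (simp add: e_def)
    have upd: "mult_update P (vit r k q) (xit r k q) (zit r k q) (muit r k (q - 1)) (muit r k q)"
      and plant: "plant_sol P x (uit r k q) (xF r k)"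
      using run[OF s] q unfolding is_dmpc_run_def r_def x_def st_def by auto
    have in_X: "xit r k q \<tau> \<in> X" if "\<tau> \<in> {0..T}" for \<tau>
      using bspec[OF Tr_admm s] that unfolding X_def r_def by force
    have xit_err: "norm (xit r k q \<tau> - xs x \<tau>) \<le> (1 + 2 / ?\<rho>) * e" if \<tau>: "\<tau> \<in> {0..T}" for \<tau>
    proof -
      have "muit r k q \<tau> = muit r k (q - 1) \<tau> + ?\<rho> *\<^sub>R (zit r k q \<tau> - xit r k q \<tau>, copies P (zit r k q \<tau>) - vit r k q \<tau>)"
        using upd \<tau> unfolding mult_update_def T_def by blast
      from decoupled_state_error[OF rho this, of "zs x \<tau>" e "\<mu>s x \<tau>"] show ?thesis
        using iter_error[OF s _ _ \<tau>, of q] iter_error[OF s _ _ \<tau>, of "q - 1"]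
          opt_consistent(1)[OF x \<tau>] by (simp add: r_def x_def e_def)
    qed
    have uit_err: "norm (uit r k q \<tau> - us x \<tau>) \<le> Lk * (3 + 2 / ?\<rho>) * e" if \<tau>: "\<tau> \<in> {0..T}" for \<tau>
    proof -
      have u1: "uit r k q \<tau> = \<kappa> (xit r k q \<tau>) (zit r k (q - 1)) (muit r k (q - 1)) x"
        using bspec[OF kappa s] \<tau> by (simp add: r_def x_def st_def)
      have u2: "us x \<tau> = \<kappa> (xs x \<tau>) (zs x) (\<mu>s x) x"
        using kappa_star kappa_eq x \<tau> xs_X[OF x \<tau>] by simp
      have nb: "zit r k (q - 1) \<in> Z\<sigma>" "muit r k (q - 1) \<in> M\<sigma>"
        using iter_nbhd[OF s, of "q - 1"] by (auto simp: r_def)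
      have "norm (uit r k q \<tau> - us x \<tau>) \<le> Lk * (norm (xit r k q \<tau> - xs x \<tau>)
          + linf_dist T (zit r k (q - 1)) (zs x) + linf_dist T (muit r k (q - 1)) (\<mu>s x))"
        unfolding u1 u2 using Lk x in_X[OF \<tau>] xs_X[OF x \<tau>] nb zs_nbhd[OF x] mus_nbhd[OF x] by blast
      also have "\<dots> \<le> Lk * ((1 + 2 / ?\<rho>) * e + e + e)"
        unfolding linf_dist_def using L_pos T xit_err[OF \<tau>] iter_error[OF s, of "q - 1"]
        by (intro mult_left_mono add_mono linf_le) (auto simp: r_def x_def e_def)
      also have "\<dots> = Lk * (3 + 2 / ?\<rho>) * e" by (simp add: algebra_simps)
      finally show ?thesis .
    qed
    have lip: "norm (Fdyn P (xF r k \<tau>) (uit r k q \<tau>) - Fdyn P (xs x \<tau>) (us x \<tau>))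
       \<le> Lf * (norm (xF r k \<tau> - xs x \<tau>) + norm (uit r k q \<tau> - us x \<tau>)
           + norm (copies P (xF r k \<tau>) - copies P (xs x \<tau>)))" if \<tau>: "\<tau> \<in> {0..T}" for \<tau>
    proof -
      have "(xF r k \<tau>, uit r k q \<tau>, copies P (xF r k \<tau>)) \<in> Tr"
        using bspec[OF Tr_plant s] \<tau> by (simp add: r_def)
      moreover have "(xs x \<tau>, us x \<tau>, copies P (xs x \<tau>)) \<in> Tr"
        using Tr_opt x \<tau> opt_consistent(2)[OF x \<tau>] by fastforce
      ultimately show ?thesis using Lf unfolding Fdyn_def by fastforce
    qed
    have "norm (xF r k t - xs x t)
        \<le> Lf * (Lk * (3 + 2 / ?\<rho>) * e) * horizon P * exp (Lf * (1 + ?N) * horizon P)"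
      by (rule plant_prediction_error[OF _ _ _ plant])
        (use L_pos rho e T opt[of x] t lip uit_err in
          \<open>auto simp: T_def optimal_solution_def admissible_def\<close>)
    also have "\<dots> = A * C ^ (q - 1) * sd q x0 k" by (simp add: A_def e_def T_def mult_ac)
    finally show ?thesis by (simp add: r_def x_def)
  qed

  have next_state: "st q x0 (Suc k) = xF (R q x0) k ?dt" if s: "(q, x0, k) \<in> steps" for q x0 k
  proof -
    have "\<forall>\<tau>\<in>{0..?dt}. plant (R q x0) (real k * ?dt + \<tau>) = xF (R q x0) k \<tau>"
      using run[OF s] unfolding is_dmpc_run_def by blast
    then show ?thesis using dt by (simp add: st_def mpc_state_def algebra_simps)
  qed
  have xF_X: "xF (R q x0) k t \<in> X" if "(q, x0, k) \<in> steps" "t \<in> {0..T}" for q x0 k t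
    using bspec[OF Tr_plant that(1)] that(2) unfolding X_def by force

  \<comment> \<open>Recursion for \<open>sqrt J\<close>: contraction by the optimal control, perturbed by the prediction error.\<close>
  define c where "c = LJ * (g / sqrt m) / \<theta> + sqrt LJ"
  have c0: "0 \<le> c" using LJ g m th by (simp add: c_def)
  have y_step: "sqrt (?J (st q x0 (Suc k))) \<le> \<theta> * sqrt (?J (st q x0 k)) + c * A * C ^ (q - 1) * sd q x0 k"
    if s: "(q, x0, k) \<in> steps" for q x0 k
  proof -
    define x x' E where "x = st q x0 k" and "x' = xs x ?dt" and "E = A * C ^ (q - 1) * sd q x0 k"
    have x: "x \<in> \<Gamma>" using st_Gamma[OF s] by (simp add: x_def)
    have dtT: "?dt \<in> {0..T}" using dt by simp
    have E: "0 \<le> E" using A C sd_nonneg[OF s] by (simp add: E_def)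
    have err: "norm (st q x0 (Suc k) - x') \<le> E"
      using pred_error[OF s dtT] next_state[OF s] by (simp add: x_def x'_def E_def)
    have bX: "norm x' \<le> BX" "norm (st q x0 (Suc k)) \<le> BX"
      using BX xs_X[OF x dtT] xF_X[OF s dtT] next_state[OF s] by (simp_all add: x'_def)
    define y where "y = sqrt (?J x)"
    have y: "0 \<le> y" using J_nonneg by (simp add: y_def)
    have nx': "norm x' \<le> g / sqrt m * y"
    proof -
      have "norm x' \<le> g * norm x" using xs_growth[OF x dtT] by (simp add: x'_def)
      also have "\<dots> \<le> g * (y / sqrt m)" using norm_le_sqrtJ[OF x] g by (intro mult_left_mono) (auto simp: y_def)
      finally show ?thesis by simp
    qed
    have n'': "norm (st q x0 (Suc k)) \<le> norm x' + E"
      using err norm_triangle_ineq2[of "st q x0 (Suc k)" x'] by linarith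
    have "?J (st q x0 (Suc k)) \<le> ?J x' + LJ * (norm x' + norm (st q x0 (Suc k))) * norm (st q x0 (Suc k) - x')"
      using LJ(2)[OF bX] by linarith
    also have "\<dots> \<le> \<theta>\<^sup>2 * y\<^sup>2 + LJ * (2 * (g / sqrt m) * y + E) * E"
    proof (rule add_mono)
      show "?J x' \<le> \<theta>\<^sup>2 * y\<^sup>2" using J_contract[OF x] J_nonneg by (simp add: y_def x'_def)
      have "norm x' + norm (st q x0 (Suc k)) \<le> 2 * (g / sqrt m) * y + E" using n'' nx' by linarith
      from mult_mono[OF mult_left_mono[OF this LJ(1)] err]
      show "LJ * (norm x' + norm (st q x0 (Suc k))) * norm (st q x0 (Suc k) - x')
          \<le> LJ * (2 * (g / sqrt m) * y + E) * E"
        using LJ g m y E by simp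
    qed
    finally have "sqrt (?J (st q x0 (Suc k))) \<le> \<theta> * y + (LJ * (g / sqrt m) / \<theta> + sqrt LJ) * E"
      using J_nonneg E y LJ g m th by (intro sqrt_perturbation) auto
    then show ?thesis by (simp add: y_def x_def E_def c_def mult.assoc)
  qed

  \<comment> \<open>Recursion for the warm-start distance: ADMM contracts it, the motion of the plant moves the target.\<close>
  define c2 where "c2 = C0 + (Lz + Lm) * A"
  define c3 where "c3 = (Lz + Lm) * ((g + 1) / sqrt m)"
  have c23: "0 \<le> c2" "0 \<le> c3" using C Lz Lm A g m by (auto simp: c2_def c3_def)
  have s_step: "sd q x0 (Suc k) \<le> c2 * C ^ (q - 1) * sd q x0 k + c3 * sqrt (?J (st q x0 k))"
    if s': "(q, x0, Suc k) \<in> steps" for q x0 k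
  proof -
    have s: "(q, x0, k) \<in> steps" using s' steps_iff by simp
    define x x1 where "x = st q x0 k" and "x1 = st q x0 (Suc k)"
    define \<eta> where "\<eta> = C ^ (q - 1) * sd q x0 k"
    have \<eta>: "0 \<le> \<eta>" using C sd_nonneg[OF s] by (simp add: \<eta>_def)
    have x: "x \<in> \<Gamma>" "x1 \<in> \<Gamma>" using st_Gamma s s' by (auto simp: x_def x1_def)
    have dtT: "?dt \<in> {0..T}" using dt by simp
    have "dist x x1 \<le> norm (x1 - xs x ?dt) + norm (xs x ?dt) + norm x"
      using norm_triangle_ineq4[of "x1 - xs x ?dt + xs x ?dt" x] norm_triangle_ineq[of "x1 - xs x ?dt" "xs x ?dt"]
      by (simp add: dist_norm norm_minus_commute)
    also have "\<dots> \<le> A * \<eta> + g * norm x + norm x"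
      using pred_error[OF s dtT] next_state[OF s] xs_growth[OF x(1) dtT]
      by (simp add: x_def x1_def \<eta>_def mult.assoc)
    also have "\<dots> = A * \<eta> + (g + 1) * norm x" by (simp add: algebra_simps)
    also have "\<dots> \<le> A * \<eta> + (g + 1) * (sqrt (?J x) / sqrt m)"
      using norm_le_sqrtJ[OF x(1)] g by (intro add_left_mono mult_left_mono) auto
    finally have dx: "dist x x1 \<le> A * \<eta> + (g + 1) / sqrt m * sqrt (?J x)" by simp
    have warm: "zit (R q x0) (Suc k) 0 t = zit (R q x0) k q t" "muit (R q x0) (Suc k) 0 t = muit (R q x0) k q t"
      if "t \<in> {0..T}" for t
      using run[OF s] that unfolding is_dmpc_run_def T_def by blast+
    have "sd q x0 (Suc k) \<le> C0 * \<eta> + (Lz + Lm) * dist x x1"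
      unfolding sd_def stack_dist_def x1_def[symmetric]
    proof (rule linf_le)
      fix t assume t: "t \<in> {0..T}"
      let ?z = "zit (R q x0) k q t" and ?m = "muit (R q x0) k q t"
      have "norm (?z - zs x t, ?m - \<mu>s x t) \<le> C0 * \<eta>"
      proof -
        have "norm (?z - zs x t, ?m - \<mu>s x t)
            \<le> stack_dist T (zit (R q x0) k q) (muit (R q x0) k q) (zs x) (\<mu>s x)"
          unfolding stack_dist_def
          by (rule norm_le_linf[where z = "\<lambda>\<tau>. (zit (R q x0) k q \<tau> - zs x \<tau>, muit (R q x0) k q \<tau> - \<mu>s x \<tau>)", OF bounded_Pair_image t])
            (intro bounded_diff_image iter_bounded[OF s order_refl] zs_bounded[OF x(1)] mus_bounded[OF x(1)])+
        also have "\<dots> \<le> C0 * C ^ q * sd q x0 k"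
          using bspec[OF h5 s] by (simp add: Let_def sd_def st_def x_def)
        also have "\<dots> \<le> C0 * C ^ (q - 1) * sd q x0 k"
          using C sd_nonneg[OF s] by (intro mult_right_mono mult_left_mono power_decreasing) auto
        finally show ?thesis by (simp add: \<eta>_def)
      qed
      moreover have "norm (zs x t - zs x1 t, \<mu>s x t - \<mu>s x1 t) \<le> (Lz + Lm) * dist x x1"
        using norm_Pair_le[of "zs x t - zs x1 t" "\<mu>s x t - \<mu>s x1 t"] Lz(2)[OF x t] Lm(2)[OF x t]
        by (simp add: algebra_simps)
      moreover have "(?z - zs x1 t, ?m - \<mu>s x1 t)
          = (?z - zs x t, ?m - \<mu>s x t) + (zs x t - zs x1 t, \<mu>s x t - \<mu>s x1 t)" by simp
      ultimately show "norm (zit (R q x0) (Suc k) 0 t - zs x1 t, muit (R q x0) (Suc k) 0 t - \<mu>s x1 t)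
          \<le> C0 * \<eta> + (Lz + Lm) * dist x x1"
        unfolding warm[OF t] by (metis add_mono norm_triangle_le)
    qed (use T in simp)
    also have "\<dots> \<le> C0 * \<eta> + (Lz + Lm) * (A * \<eta> + (g + 1) / sqrt m * sqrt (?J x))"
      using dx Lz Lm by (intro add_left_mono mult_left_mono) auto
    finally show ?thesis by (simp add: c2_def c3_def \<eta>_def x_def algebra_simps)
  qed

  \<comment> \<open>All initial trajectories lie in neighbourhoods of bounded sets, so the initial distance is bounded uniformly.\<close>
  define S where "S = 2 * Bz + \<sigma>z + (2 * Bm + \<sigma>\<mu>)"
  have S: "0 \<le> S" using Bz Bm sigma_pos by (simp add: S_def)
  have s_init: "sd q x0 0 \<le> S" if s: "(q, x0, 0) \<in> steps" for q x0
    unfolding sd_def stack_dist_def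
  proof (rule linf_le)
    let ?x = "st q x0 0" and ?z = "zit (R q x0) 0 0" and ?m = "muit (R q x0) 0 0"
    have x: "?x \<in> \<Gamma>" by (rule st_Gamma[OF s])
    fix t assume t: "t \<in> {0..T}"
    obtain x1 where x1: "x1 \<in> \<Gamma>" "norm (?z t - zs x1 t) \<le> \<sigma>z"
      using iter_nbhd(1)[OF s, of 0] t unfolding Z\<sigma>_def sigma_nbhd_def Z\<alpha>_def by auto
    obtain x2 where x2: "x2 \<in> \<Gamma>" "norm (?m t - \<mu>s x2 t) \<le> \<sigma>\<mu>"
      using iter_nbhd(2)[OF s, of 0] t unfolding M\<sigma>_def sigma_nbhd_def M\<alpha>_def by auto
    have "norm (?z t - zs ?x t) \<le> norm (?z t - zs x1 t) + (norm (zs x1 t) + norm (zs ?x t))"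
      using norm_triangle_ineq[of "?z t - zs x1 t" "zs x1 t - zs ?x t"] norm_triangle_ineq4[of "zs x1 t" "zs ?x t"] by simp
    moreover have "norm (?m t - \<mu>s ?x t) \<le> norm (?m t - \<mu>s x2 t) + (norm (\<mu>s x2 t) + norm (\<mu>s ?x t))"
      using norm_triangle_ineq[of "?m t - \<mu>s x2 t" "\<mu>s x2 t - \<mu>s ?x t"] norm_triangle_ineq4[of "\<mu>s x2 t" "\<mu>s ?x t"] by simp
    ultimately show "norm (?z t - zs ?x t, ?m t - \<mu>s ?x t) \<le> S"
      using norm_Pair_le[of "?z t - zs ?x t" "?m t - \<mu>s ?x t"] x1 x2 Bz(2)[OF x t] Bz(2)[OF x1(1) t]
        Bm(2)[OF x t] Bm(2)[OF x2(1) t] unfolding S_def by linarith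
  qed (use T in simp)

  have "ml \<le> Ml"
  proof -
    obtain x :: "real ^ 'n" where "norm x = 1" using vector_choose_size[of 1] by auto
    then show ?thesis using ctl.lfun_lower[of x 0] ctl.lfun_upper[of x 0] by simp
  qed
  then have ah: "\<alpha>h < \<alpha>"
    unfolding \<alpha>h_def using T rho dt ml MV L_pos C d_pos alpha by (intro alpha_hat_less) (auto simp: T_def)
  then have sqrt_ah: "sqrt \<alpha>h < sqrt \<alpha>" "0 < sqrt \<alpha>" using alpha by auto
  have cA: "0 \<le> c * A" using c0 A by simp
  obtain w r \<epsilon> where w: "0 < w" and r: "0 < r" "r < 1" and \<epsilon>: "0 < \<epsilon>" and decay:
    "\<And>\<eta> y s k. \<lbrakk>0 \<le> \<eta>; \<eta> \<le> \<epsilon>; y 0 \<le> sqrt \<alpha>h; s 0 \<le> S; \<And>k. 0 \<le> y k;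
       \<And>k. \<forall>j\<le>k. y j \<le> sqrt \<alpha> \<Longrightarrow> 0 \<le> s k;
       \<And>k. \<forall>j\<le>k. y j \<le> sqrt \<alpha> \<Longrightarrow> y (Suc k) \<le> \<theta> * y k + c * A * \<eta> * s k;
       \<And>k. \<forall>j\<le>Suc k. y j \<le> sqrt \<alpha> \<Longrightarrow> s (Suc k) \<le> c2 * \<eta> * s k + c3 * y k\<rbrakk>
     \<Longrightarrow> y k \<le> sqrt \<alpha> \<and> y k + w * s k \<le> sqrt \<alpha> * r ^ k"
    using coupled_decay[OF less_imp_le[OF th(1)] th(2) cA c23 sqrt_ah S] by metis
  \<comment> \<open>This fixes the number of iterations independently of the initial state; the coupling factor is \<open>C\<^sup>n\<close> with \<open>n = q - 1\<close>.\<close>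
  obtain n where n: "C ^ n < \<epsilon>" using real_arch_pow_inv[OF \<epsilon> C(3)] by blast
  define q where "q = Suc n"
  \<comment> \<open>The bound on \<open>y\<close> up to step \<open>k\<close> says that the states so far lie in \<open>\<Gamma>\<close>, so both recursions are available.\<close>
  define y where "y x0 k = sqrt (?J (st q x0 k))" for x0 k
  have in_steps: "(q, x0, k) \<in> steps" if "x0 \<in> \<Gamma>h" "\<forall>j\<le>k. y x0 j \<le> sqrt \<alpha>" for x0 k
    using that by (simp add: steps_iff Gamma_iff y_def q_def)
  have st0: "st q x0 0 = x0" if "x0 \<in> \<Gamma>h" for x0
    using scheme that by (simp add: is_dmpc_run_def st_def mpc_state_def q_def)
  have main: "y x0 k \<le> sqrt \<alpha> \<and> y x0 k + w * sd q x0 k \<le> sqrt \<alpha> * r ^ k" if x0: "x0 \<in> \<Gamma>h" for x0 k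
  proof (rule decay[where \<eta> = "C ^ n" and y = "y x0" and s = "sd q x0"])
    show "0 \<le> C ^ n" "C ^ n \<le> \<epsilon>" using C n by auto
    show y0: "y x0 0 \<le> sqrt \<alpha>h"
      using x0 by (simp add: y_def st0[OF x0] \<Gamma>h_def level_set_def)
    have "y x0 0 \<le> sqrt \<alpha>" using y0 less_imp_le[OF sqrt_ah(1)] by (rule order_trans)
    then have "\<forall>j\<le>0. y x0 j \<le> sqrt \<alpha>" by simp
    then show "sd q x0 0 \<le> S" by (intro s_init in_steps x0)
    show "0 \<le> y x0 k" for k by (simp add: y_def J_nonneg)
    show "0 \<le> sd q x0 k" if "\<forall>j\<le>k. y x0 j \<le> sqrt \<alpha>" for k
      by (rule sd_nonneg[OF in_steps[OF x0 that]])
    show "y x0 (Suc k) \<le> \<theta> * y x0 k + c * A * C ^ n * sd q x0 k" if "\<forall>j\<le>k. y x0 j \<le> sqrt \<alpha>" for k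
      using y_step[OF in_steps[OF x0 that]] by (simp add: y_def q_def)
    show "sd q x0 (Suc k) \<le> c2 * C ^ n * sd q x0 k + c3 * y x0 k" if "\<forall>j\<le>Suc k. y x0 j \<le> sqrt \<alpha>" for k
      using s_step[OF in_steps[OF x0 that]] by (simp add: y_def q_def)
  qed
  have all_steps: "(q, x0, k) \<in> steps" if "x0 \<in> \<Gamma>h" for x0 k using in_steps main that by blast
  have y_nonneg: "0 \<le> y x0 k" for x0 k by (simp add: y_def J_nonneg)
  have y_decay: "y x0 k \<le> sqrt \<alpha> * r ^ k" and s_decay: "sd q x0 k \<le> sqrt \<alpha> / w * r ^ k"
    if x0: "x0 \<in> \<Gamma>h" for x0 k
  proof -
    have "0 \<le> w * sd q x0 k" using w sd_nonneg[OF all_steps[OF x0]] by simp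
    then show "y x0 k \<le> sqrt \<alpha> * r ^ k" using main[OF x0, of k] by linarith
    have "w * sd q x0 k \<le> sqrt \<alpha> * r ^ k" using main[OF x0, of k] y_nonneg[of x0 k] by linarith
    then show "sd q x0 k \<le> sqrt \<alpha> / w * r ^ k" using w by (simp add: field_simps)
  qed
  define B where "B = A * (sqrt \<alpha> / w)"
  have B: "0 \<le> B" using A w alpha by (simp add: B_def)
  have err_decay: "norm (xF (R q x0) k t - xs (st q x0 k) t) \<le> B * r ^ k"
    if x0: "x0 \<in> \<Gamma>h" and t: "t \<in> {0..T}" for x0 k t
  proof -
    have "norm (xF (R q x0) k t - xs (st q x0 k) t) \<le> A * C ^ (q - 1) * sd q x0 k"
      by (rule pred_error[OF all_steps[OF x0] t])
    also have "\<dots> \<le> A * 1 * (sqrt \<alpha> / w * r ^ k)"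
      using A C s_decay[OF x0] sd_nonneg[OF all_steps[OF x0]]
      by (intro mult_mono mult_left_mono power_le_one) auto
    finally show ?thesis by (simp add: B_def)
  qed
  define D where "D = g * (sqrt \<alpha> / sqrt m) + B"
  have D: "0 < D" using g alpha m B by (simp add: D_def add_pos_nonneg)
  have xF_decay: "norm (xF (R q x0) k t) \<le> D * r ^ k" if x0: "x0 \<in> \<Gamma>h" and t: "t \<in> {0..T}" for x0 k t
  proof -
    note x = st_Gamma[OF all_steps[OF x0], of k]
    have "norm (xs (st q x0 k) t) \<le> g * norm (st q x0 k)" by (rule xs_growth[OF x t])
    also have "\<dots> \<le> g * (y x0 k / sqrt m)"
      using norm_le_sqrtJ[OF x] g by (intro mult_left_mono) (auto simp: y_def)
    also have "\<dots> \<le> g * (sqrt \<alpha> * r ^ k / sqrt m)"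
      using y_decay[OF x0] g m by (intro mult_left_mono divide_right_mono) auto
    finally have "norm (xs (st q x0 k) t) \<le> g * (sqrt \<alpha> / sqrt m) * r ^ k" by simp
    then show ?thesis
      using err_decay[OF x0 t, of k] norm_triangle_ineq2[of "xF (R q x0) k t" "xs (st q x0 k) t"]
      by (simp add: D_def algebra_simps)
  qed

  have "uniform_exp_decay \<Gamma>h (\<lambda>x0 k. ?J (st q x0 k))"
  proof (rule uniform_exp_decayI)
    show "0 < \<alpha>" "0 < r\<^sup>2" "r\<^sup>2 < 1" using alpha r by (auto simp: power_less_one_iff abs_square_less_1)
    fix x0 k assume x0: "x0 \<in> \<Gamma>h"
    have "?J (st q x0 k) = (y x0 k)\<^sup>2" using J_nonneg by (simp add: y_def)
    also have "\<dots> \<le> (sqrt \<alpha> * r ^ k)\<^sup>2" by (intro power_mono y_decay[OF x0] y_nonneg)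
    also have "\<dots> = \<alpha> * (r\<^sup>2) ^ k" using alpha by (simp add: power_mult_distrib power_mult[symmetric] mult.commute)
    finally show "?J (st q x0 k) \<le> \<alpha> * (r\<^sup>2) ^ k" .
  qed
  moreover have "uniform_exp_decay \<Gamma>h (\<lambda>x0 k. linf T (\<lambda>\<tau>. xF (R q x0) k \<tau> - xs (st q x0 k) \<tau>))"
  proof (rule uniform_exp_decayI)
    show "0 < B + 1" "0 < r" "r < 1" using B r by auto
    fix x0 k assume x0: "x0 \<in> \<Gamma>h"
    show "linf T (\<lambda>\<tau>. xF (R q x0) k \<tau> - xs (st q x0 k) \<tau>) \<le> (B + 1) * r ^ k"
    proof (rule linf_le)
      fix t assume t: "t \<in> {0..T}"
      have "B * r ^ k \<le> (B + 1) * r ^ k" using r by (intro mult_right_mono) auto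
      with err_decay[OF x0 t, of k]
      show "norm (xF (R q x0) k t - xs (st q x0 k) t) \<le> (B + 1) * r ^ k" by (rule order_trans)
    qed (use T in simp)
  qed
  moreover have "\<exists>\<gamma>1>0. \<exists>\<gamma>2>0. \<forall>x0\<in>\<Gamma>h. \<forall>t\<ge>0. norm (plant (R q x0) t) \<le> \<gamma>1 * exp (- \<gamma>2 * t)"
  proof -
    \<comment> \<open>A time \<open>t\<close> lies in step \<open>k > t / \<Delta>t - 1\<close>, which turns \<open>r\<^sup>k\<close> into an exponential of \<open>t\<close>.\<close>
    define \<gamma> where "\<gamma> = - ln r / ?dt"
    have "norm (plant (R q x0) t) \<le> D / r * exp (- \<gamma> * t)" if x0: "x0 \<in> \<Gamma>h" and t: "0 \<le> t" for x0 and t :: real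
    proof -
    define k where "k = nat \<lfloor>t / ?dt\<rfloor>"
    have k: "real k \<le> t / ?dt" "t / ?dt < real k + 1"
      using t dt by (simp_all add: k_def)
    define \<tau> where "\<tau> = t - real k * ?dt"
    have \<tau>: "\<tau> \<in> {0..?dt}" using k dt by (auto simp: \<tau>_def field_simps)
    have "\<forall>\<tau>\<in>{0..?dt}. plant (R q x0) (real k * ?dt + \<tau>) = xF (R q x0) k \<tau>"
      using run[OF all_steps[OF x0]] unfolding is_dmpc_run_def by blast
    then have "plant (R q x0) t = xF (R q x0) k \<tau>" using \<tau> by (metis \<tau>_def add.commute diff_add_cancel)
    then have "norm (plant (R q x0) t) \<le> D * r ^ k" using xF_decay[OF x0, of \<tau> k] \<tau> dt by simp
    also have "\<dots> \<le> D * r powr (t / ?dt - 1)"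
    proof (rule mult_left_mono)
      have "r ^ k = r powr real k" using r by (simp add: powr_realpow)
      also have "\<dots> \<le> r powr (t / ?dt - 1)" using r k by (intro powr_mono') auto
      finally show "r ^ k \<le> r powr (t / ?dt - 1)" .
    qed (use D in simp)
    also have "r powr (t / ?dt - 1) = exp (- \<gamma> * t) / r"
    proof -
      have "r powr (t / ?dt - 1) = exp (t / ?dt * ln r) / r"
        using r by (simp add: powr_def left_diff_distrib exp_diff)
      also have "t / ?dt * ln r = - \<gamma> * t" by (simp add: \<gamma>_def)
      finally show ?thesis .
    qed
    finally show ?thesis by simp
    qed
    moreover have "0 < D / r" "0 < \<gamma>" using D r dt by (auto simp: \<gamma>_def divide_neg_pos)
    ultimately show ?thesis by blast
  qed
  ultimately show ?thesis unfolding st_def by (intro exI[of _ q]) (auto simp: q_def)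
qed

end
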